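(* Let $k,s,d\ge1$ be integers and $\delta>0$. There exists a constant $C(k,s,d,\delta)>0$, depending only on $k,s,d,\delta$, such that the following holds. Let $h>0$ and let $\Omega_h$ be a smooth, bounded, open subset of $\mathbb{R}^d$ with diameter at most $h$ and $B(0,\delta h/2)\subset\Omega_h$. Let $\mathcal{L}=(-1)^k\sum_{|\sigma|=k}D^{2\sigma}$ with the homogeneous Dirichlet boundary condition on $\partial\Omega_h$, i.e. for $f\in L^2(\Omega_h)$, $u=\mathcal{L}^{-1}f$ is the weak solution of $(-1)^k\sum_{|\sigma|=k}D^{2\sigma}u=f$ in $\Omega_h$, $u\in H_0^k(\Omega_h)$. Let $\mathcal{P}_{s-1}$ be the space of polynomials of degree not greater than $s-1$. Then $$\|\mathcal{L}u_h\|_{L^2(\Omega_h)}\le C(k,s,d,\delta)\,h^{-k}\,|u_h|_{k,2,\Omega_h}\qquad\forall u_h\in\mathcal{L}^{-1}\mathcal{P}_{s-1}.$$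
   Context: $|u|_{k,2,\Omega}=\big(\sum_{|\sigma|=k}\int_\Omega|D^\sigma u|^2\big)^{1/2}$. $B(0,r)$ is the ball of radius $r$ centered at the origin. *)

theory Defs
  imports "HOL-Analysis.Analysis"
begin

type_synonym 'n multi_index = "'n \<Rightarrow> nat"

definition mi_order :: "'n::finite multi_index \<Rightarrow> nat" where
  "mi_order \<sigma> = (\<Sum>i\<in>UNIV. \<sigma> i)"

(* Hence sums over multi-indices of bounded order are genuine finite sums. *)
lemma finite_multi_indices: "finite {\<sigma> :: 'n::finite multi_index. mi_order \<sigma> \<le> m}"
proof -
  have "{\<sigma> :: 'n multi_index. mi_order \<sigma> \<le> m} \<subseteq> (UNIV :: 'n set) \<rightarrow>\<^sub>E {..m}"
  proof
    fix \<sigma> :: "'n multi_index"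
    assume "\<sigma> \<in> {\<sigma>. mi_order \<sigma> \<le> m}"
    moreover have "\<sigma> i \<le> mi_order \<sigma>" for i
      unfolding mi_order_def by (rule member_le_sum) auto
    ultimately show "\<sigma> \<in> UNIV \<rightarrow>\<^sub>E {..m}"
      by (auto intro: order_trans)
  qed
  then show ?thesis
    by (rule finite_subset) (simp add: finite_PiE)
qed

definition partial_deriv :: "'n \<Rightarrow> (real^'n \<Rightarrow> real) \<Rightarrow> real^'n \<Rightarrow> real" where
  "partial_deriv i f = (\<lambda>x. frechet_derivative f (at x) (axis i 1))"

definition iter_partial :: "'n list \<Rightarrow> (real^'n \<Rightarrow> real) \<Rightarrow> real^'n \<Rightarrow> real" where
  "iter_partial is f = foldr partial_deriv is f"

(* If every iterated partial derivative is differentiable, then every iterated partial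
   derivative is continuous, so this is C^infinity on the whole space. *)
definition smooth :: "(real^'n \<Rightarrow> real) \<Rightarrow> bool" where
  "smooth f \<longleftrightarrow> (\<forall>is. iter_partial is f differentiable_on UNIV)"

(* The index type carries no order, so an order of differentiation is chosen; for smooth
   functions, the only ones to which D is applied, the result does not depend on it. *)
definition D :: "'n multi_index \<Rightarrow> (real^'n \<Rightarrow> real) \<Rightarrow> real^'n \<Rightarrow> real" where
  "D \<sigma> = iter_partial (SOME is. \<forall>i. count_list is i = \<sigma> i)"

lemma ex_list_of_multi_index:
  fixes \<sigma> :: "'n::finite multi_index"
  shows "\<exists>is. \<forall>i. count_list is i = \<sigma> i"
proof -
  have "\<exists>is. \<forall>i. count_list is i = (if i \<in> A then \<sigma> i else 0)" if "finite A" for A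
    using that
  proof (induction A)
    case empty
    show ?case by (intro exI[of _ "[]"]) simp
  next
    case (insert a A)
    then obtain xs where "\<forall>i. count_list xs i = (if i \<in> A then \<sigma> i else 0)" by blast
    moreover have "count_list (replicate m a) i = (if i = a then m else 0)" for m i
      by (induction m) auto
    ultimately show ?case
      using insert.hyps by (intro exI[of _ "replicate (\<sigma> a) a @ xs"]) auto
  qed
  from this[OF finite_class.finite_UNIV] show ?thesis by simp
qed

definition test_functions :: "(real^'n) set \<Rightarrow> (real^'n \<Rightarrow> real) set" where
  "test_functions \<Omega> =
     {\<phi>. smooth \<phi> \<and> compact (closure {x. \<phi> x \<noteq> 0}) \<and> closure {x. \<phi> x \<noteq> 0} \<subseteq> \<Omega>}"

(* Near each boundary point the set is, after relabelling and reflecting the axes, the region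
   above the graph of a smooth function of the other coordinates.  Since the index type of the
   remaining coordinates is not available, that function is a smooth function on the whole
   space that does not depend on coordinate i. *)
definition smooth_boundary :: "(real^'n) set \<Rightarrow> bool" where
  "smooth_boundary \<Omega> \<longleftrightarrow>
     (\<forall>x0\<in>frontier \<Omega>. \<exists>r>0. \<exists>i. \<exists>c\<in>{1, -1}. \<exists>\<gamma>.
        smooth \<gamma> \<and> (\<forall>x y. (\<forall>j. j \<noteq> i \<longrightarrow> x $ j = y $ j) \<longrightarrow> \<gamma> x = \<gamma> y) \<and>
        \<Omega> \<inter> ball x0 r = {x \<in> ball x0 r. c * x $ i > \<gamma> x})"

(* Elements are functions on the whole space, of which only the restriction to \<Omega>, up to
   null sets, is relevant. *)
definition L2 :: "(real^'n) set \<Rightarrow> (real^'n \<Rightarrow> real) set" where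
  "L2 \<Omega> = {f \<in> borel_measurable (lebesgue_on \<Omega>). integrable (lebesgue_on \<Omega>) (\<lambda>x. (f x)\<^sup>2)}"

definition L2_norm_on :: "(real^'n) set \<Rightarrow> (real^'n \<Rightarrow> real) \<Rightarrow> real" where
  "L2_norm_on \<Omega> f = sqrt (LINT x|lebesgue_on \<Omega>. (f x)\<^sup>2)"

definition locally_integrable :: "(real^'n) set \<Rightarrow> (real^'n \<Rightarrow> real) \<Rightarrow> bool" where
  "locally_integrable \<Omega> f \<longleftrightarrow> (\<forall>K. compact K \<and> K \<subseteq> \<Omega> \<longrightarrow> f absolutely_integrable_on K)"

definition has_weak_deriv ::
  "(real^'n) set \<Rightarrow> 'n multi_index \<Rightarrow> (real^'n \<Rightarrow> real) \<Rightarrow> (real^'n \<Rightarrow> real) \<Rightarrow> bool" where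
  "has_weak_deriv \<Omega> \<sigma> u v \<longleftrightarrow> locally_integrable \<Omega> u \<and> locally_integrable \<Omega> v \<and>
     (\<forall>\<phi>\<in>test_functions \<Omega>.
        (LINT x|lebesgue_on \<Omega>. u x * D \<sigma> \<phi> x) =
        (-1) ^ mi_order \<sigma> * (LINT x|lebesgue_on \<Omega>. v x * \<phi> x))"

(* A weak derivative is unique up to null sets; this is some representative of it. *)
definition weak_deriv ::
  "(real^'n) set \<Rightarrow> 'n multi_index \<Rightarrow> (real^'n \<Rightarrow> real) \<Rightarrow> real^'n \<Rightarrow> real" where
  "weak_deriv \<Omega> \<sigma> u = (SOME v. has_weak_deriv \<Omega> \<sigma> u v)"

definition Hk :: "nat \<Rightarrow> (real^'n) set \<Rightarrow> (real^'n \<Rightarrow> real) set" where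
  "Hk k \<Omega> = {u \<in> L2 \<Omega>. \<forall>\<sigma>. mi_order \<sigma> \<le> k \<longrightarrow> (\<exists>v\<in>L2 \<Omega>. has_weak_deriv \<Omega> \<sigma> u v)}"

definition Hk_seminorm :: "nat \<Rightarrow> (real^'n) set \<Rightarrow> (real^'n \<Rightarrow> real) \<Rightarrow> real" where
  "Hk_seminorm k \<Omega> u =
     sqrt (\<Sum>\<sigma> | mi_order \<sigma> = k. LINT x|lebesgue_on \<Omega>. (weak_deriv \<Omega> \<sigma> u x)\<^sup>2)"

definition Hk_norm :: "nat \<Rightarrow> (real^'n) set \<Rightarrow> (real^'n \<Rightarrow> real) \<Rightarrow> real" where
  "Hk_norm k \<Omega> u = sqrt (\<Sum>j\<le>k. (Hk_seminorm j \<Omega> u)\<^sup>2)"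

definition H0k :: "nat \<Rightarrow> (real^'n) set \<Rightarrow> (real^'n \<Rightarrow> real) set" where
  "H0k k \<Omega> = {u \<in> Hk k \<Omega>. \<exists>\<phi> :: nat \<Rightarrow> real^'n \<Rightarrow> real.
     (\<forall>m. \<phi> m \<in> test_functions \<Omega>) \<and>
     (\<lambda>m. Hk_norm k \<Omega> (\<lambda>x. u x - \<phi> m x)) \<longlonglongrightarrow> 0}"

(* f = (-1)^k * sum of D^(2 sigma) u over |sigma| = k, in the sense of distributions on \<Omega>;
   the sign (-1)^(2 |sigma|) from moving the derivatives onto the test function is 1. *)
definition is_calL ::
  "nat \<Rightarrow> (real^'n) set \<Rightarrow> (real^'n \<Rightarrow> real) \<Rightarrow> (real^'n \<Rightarrow> real) \<Rightarrow> bool" where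
  "is_calL k \<Omega> u f \<longleftrightarrow>
     (\<forall>\<phi>\<in>test_functions \<Omega>.
        (LINT x|lebesgue_on \<Omega>. f x * \<phi> x) =
        (-1) ^ k * (\<Sum>\<sigma> | mi_order \<sigma> = k. LINT x|lebesgue_on \<Omega>. u x * D (\<lambda>i. 2 * \<sigma> i) \<phi> x))"

(* As an element of L^2, f is unique up to null sets; this is some representative of it. *)
definition calL :: "nat \<Rightarrow> (real^'n) set \<Rightarrow> (real^'n \<Rightarrow> real) \<Rightarrow> real^'n \<Rightarrow> real" where
  "calL k \<Omega> u = (SOME f. f \<in> L2 \<Omega> \<and> is_calL k \<Omega> u f)"

definition weak_solution ::
  "nat \<Rightarrow> (real^'n) set \<Rightarrow> (real^'n \<Rightarrow> real) \<Rightarrow> (real^'n \<Rightarrow> real) \<Rightarrow> bool" where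
  "weak_solution k \<Omega> f u \<longleftrightarrow> u \<in> H0k k \<Omega> \<and>
     (\<forall>v\<in>H0k k \<Omega>.
        (\<Sum>\<sigma> | mi_order \<sigma> = k. LINT x|lebesgue_on \<Omega>. weak_deriv \<Omega> \<sigma> u x * weak_deriv \<Omega> \<sigma> v x) =
        (LINT x|lebesgue_on \<Omega>. f x * v x))"

(* The image of F under the solution operator f \<mapsto> u: all representatives of all solutions. *)
definition calL_inv_image ::
  "nat \<Rightarrow> (real^'n) set \<Rightarrow> (real^'n \<Rightarrow> real) set \<Rightarrow> (real^'n \<Rightarrow> real) set" where
  "calL_inv_image k \<Omega> F = {u. \<exists>f\<in>F. f \<in> L2 \<Omega> \<and> weak_solution k \<Omega> f u}"

definition polys :: "nat \<Rightarrow> (real^'n \<Rightarrow> real) set" where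
  "polys m = {p. \<exists>a :: 'n multi_index \<Rightarrow> real.
     p = (\<lambda>x. \<Sum>\<sigma> | mi_order \<sigma> \<le> m. a \<sigma> * (\<Prod>i\<in>UNIV. x $ i ^ \<sigma> i))}"

end

theory Submission
  imports Defs
begin

text \<open>Let \<open>f\<close> be the polynomial with \<open>u = L\<^sup>-\<^sup>1 f\<close>, so that \<open>L u = f\<close> almost everywhere by the
  fundamental lemma of the calculus of variations. Test the weak equation with
  \<open>v(x) = \<eta>(x / h) f(x)\<close>, where \<open>\<eta>\<close> is a fixed bump function supported in the ball of radius
  \<open>\<delta> / 2\<close>. In the coefficients \<open>b\<close> of the rescaled polynomial \<open>y \<mapsto> f(h y)\<close>, the left-hand side
  \<open>\<integral> f v\<close> is at least \<open>c h\<^sup>d |b|\<^sup>2\<close> (a definite quadratic form on a finite-dimensional space),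
  while \<open>|v|\<^sub>k\<close> is at most a constant times \<open>h\<^sup>-\<^sup>k |b| h\<^sup>d\<^sup>/\<^sup>2\<close>, and \<open>\<parallel>f\<parallel>\<close> is at most a constant
  times \<open>|b| h\<^sup>d\<^sup>/\<^sup>2\<close> because the domain lies in the cube of side \<open>2 h\<close>. The Cauchy-Schwarz
  inequality then gives the estimate with a constant independent of the domain.\<close>

section \<open>Smooth functions\<close>

text \<open>\<open>f\<close> cannot be tested against itself: it need not vanish at the boundary, so
  it need not lie in \<open>H0k\<close>. The cut-off has to live where every admissible domain has
  room, which is the ball around the origin. The price is that the square integral of f over the
  whole domain must be controlled by a weighted integral over a small cube. For polynomials of
  bounded degree this costs only a constant, since all norms of finitely many coefficients are
  equivalent. After rescaling by h, neither the bump nor the bounds on derivatives depend on h or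
  the domain; h^(-k) is the k-fold chain rule. The second obstacle is that \<open>D\<close>,
  \<open>weak_deriv\<close> and \<open>calL\<close> are values of a choice operator. Symmetry of
  mixed partials makes \<open>D\<close> independent of the chosen order, and the fundamental lemma
  makes the other two unique up to null sets. As v is smooth with compact support, its weak
  derivatives are the classical ones, so |v|_k can be bounded pointwise.\<close>

lemma partial_deriv_eq:
  "(f has_derivative f') (at x) \<Longrightarrow> partial_deriv i f x = f' (axis i 1)"
  unfolding partial_deriv_def using frechet_derivative_at by metis

lemma iter_partial_Nil [simp]: "iter_partial [] f = f"
  by (simp add: iter_partial_def)

lemma iter_partial_Cons [simp]: "iter_partial (i # is) f = partial_deriv i (iter_partial is f)"
  by (simp add: iter_partial_def)

lemma iter_partial_append: "iter_partial (is @ js) f = iter_partial is (iter_partial js f)"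
  by (simp add: iter_partial_def)

text \<open>Smoothness concerns derivatives of every order. A set of differentiable functions stable
  under \<open>partial_deriv\<close> settles all orders at once, without formulas for higher
  derivatives.\<close>

lemma smooth_coinduct:
  fixes f :: "real^'n::finite \<Rightarrow> real"
  assumes "f \<in> S" and "\<And>g x. g \<in> S \<Longrightarrow> g differentiable (at x)"
    and "\<And>g i. g \<in> S \<Longrightarrow> partial_deriv i g \<in> S"
  shows "smooth f"
proof -
  have "iter_partial is f \<in> S" for "is"
    by (induction "is") (use assms in auto)
  then show ?thesis
    unfolding smooth_def differentiable_on_def using assms(2) by blast
qed

lemma smooth_differentiable: "smooth f \<Longrightarrow> f differentiable (at x)"
  unfolding smooth_def differentiable_on_def by (metis UNIV_I iter_partial_Nil)

lemma smooth_has_derivative: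
  "smooth f \<Longrightarrow> (f has_derivative frechet_derivative f (at x)) (at x)"
  using smooth_differentiable frechet_derivative_works by blast

lemma smooth_partial_deriv: "smooth f \<Longrightarrow> smooth (partial_deriv i f)"
  unfolding smooth_def
proof
  fix "is" assume "\<forall>is. iter_partial is f differentiable_on UNIV"
  \<comment> \<open>The innermost derivative is the last entry of the list, so \<open>i\<close> is
    appended at the end.\<close>
  then show "iter_partial is (partial_deriv i f) differentiable_on UNIV"
    using iter_partial_append[of "is" "[i]" f] by (metis iter_partial_Cons iter_partial_Nil)
qed

lemma smooth_iter_partial: "smooth f \<Longrightarrow> smooth (iter_partial is f)"
  by (induction "is") (auto intro: smooth_partial_deriv)

lemma smooth_D: "smooth f \<Longrightarrow> smooth (D \<sigma> f)"
  unfolding D_def by (rule smooth_iter_partial)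

lemma smooth_continuous_on:
  fixes f :: "real^'n::finite \<Rightarrow> real"
  shows "smooth f \<Longrightarrow> continuous_on A f"
  by (meson continuous_at_imp_continuous_on differentiable_imp_continuous_within smooth_differentiable)

section \<open>Sum and product rules, and closure of smooth functions under algebra\<close>

lemma partial_deriv_add:
  assumes "f differentiable (at x)" "g differentiable (at x)"
  shows "partial_deriv i (\<lambda>x. f x + g x) x = partial_deriv i f x + partial_deriv i g x"
  using has_derivative_add[OF assms[unfolded frechet_derivative_works], THEN partial_deriv_eq]
  by (simp add: partial_deriv_def)

lemma partial_deriv_mult:
  assumes "f differentiable (at x)" "g differentiable (at x)"
  shows "partial_deriv i (\<lambda>x. f x * g x) x = f x * partial_deriv i g x + partial_deriv i f x * g x"
  using has_derivative_mult[OF assms[unfolded frechet_derivative_works], THEN partial_deriv_eq]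
  by (simp add: partial_deriv_def)

lemma partial_deriv_const: "partial_deriv i (\<lambda>x. c) = (\<lambda>x. 0)"
  by (rule ext, rule partial_deriv_eq) (rule has_derivative_const)

text \<open>The derivative of a product is a sum of products, so products alone are not stable under
  \<open>partial_deriv\<close>. Closing under both operations gives a set to which
  \<open>smooth_coinduct\<close> applies.\<close>

inductive_set smooth_algebra :: "(real^'n::finite \<Rightarrow> real) set" where
  base: "smooth f \<Longrightarrow> f \<in> smooth_algebra"
| add: "f \<in> smooth_algebra \<Longrightarrow> g \<in> smooth_algebra \<Longrightarrow> (\<lambda>x. f x + g x) \<in> smooth_algebra"
| mult: "f \<in> smooth_algebra \<Longrightarrow> g \<in> smooth_algebra \<Longrightarrow> (\<lambda>x. f x * g x) \<in> smooth_algebra"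

lemma smooth_algebra_smooth:
  assumes "f \<in> smooth_algebra" shows "smooth f"
proof (rule smooth_coinduct[OF assms])
  show diff: "g differentiable (at x)" if "g \<in> smooth_algebra" for g :: "real^'n \<Rightarrow> real" and x
    using that by induction (auto intro: smooth_differentiable)
  show "partial_deriv i g \<in> smooth_algebra" if "g \<in> smooth_algebra" for g :: "real^'n \<Rightarrow> real" and i
    using that
  proof induction
    case (base f) then show ?case by (intro smooth_algebra.base smooth_partial_deriv)
  next
    case (add f g)
    then have "partial_deriv i (\<lambda>x. f x + g x) = (\<lambda>x. partial_deriv i f x + partial_deriv i g x)"
      by (intro ext partial_deriv_add diff)
    with add show ?case by (auto intro: smooth_algebra.add)
  next
    case (mult f g)
    then have "partial_deriv i (\<lambda>x. f x * g x)
        = (\<lambda>x. f x * partial_deriv i g x + partial_deriv i f x * g x)"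
      by (intro ext partial_deriv_mult diff)
    with mult show ?case by (auto intro: smooth_algebra.add smooth_algebra.mult)
  qed
qed

lemma smooth_add: "smooth f \<Longrightarrow> smooth g \<Longrightarrow> smooth (\<lambda>x. f x + g x)"
  by (rule smooth_algebra_smooth, intro smooth_algebra.add smooth_algebra.base)

lemma smooth_mult: "smooth f \<Longrightarrow> smooth g \<Longrightarrow> smooth (\<lambda>x. f x * g x)"
  by (rule smooth_algebra_smooth, intro smooth_algebra.mult smooth_algebra.base)

lemma smooth_const: "smooth (\<lambda>x::real^'n::finite. c)"
  by (rule smooth_coinduct[of _ "range (\<lambda>c x. c)"]) (auto simp: partial_deriv_const)

lemma smooth_coordinate: "smooth (\<lambda>x::real^'n::finite. x $ i)"
proof (rule smooth_coinduct[of _ "insert (\<lambda>x. x $ i) (range (\<lambda>c x. c))"])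
  have *: "((\<lambda>x::real^'n. x $ i) has_derivative (\<lambda>x. x $ i)) (at x)" for x
    by (rule bounded_linear_imp_has_derivative[OF bounded_linear_vec_nth])
  show "g differentiable (at x)"
    if "g \<in> insert (\<lambda>x. x $ i) (range (\<lambda>c x. c))" for g :: "real^'n \<Rightarrow> real" and x
    using that * by (auto simp: differentiable_def intro: has_derivative_const)
  have "partial_deriv j (\<lambda>x::real^'n. x $ i) = (\<lambda>x. axis j 1 $ i)" for j
    by (rule ext, rule partial_deriv_eq) (rule *)
  then show "partial_deriv j g \<in> insert (\<lambda>x. x $ i) (range (\<lambda>c x. c))"
    if "g \<in> insert (\<lambda>x. x $ i) (range (\<lambda>c x. c))" for g :: "real^'n \<Rightarrow> real" and j
    using that by (auto simp: partial_deriv_const)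
qed simp

lemma smooth_sum: "(\<And>a. a \<in> A \<Longrightarrow> smooth (f a)) \<Longrightarrow> smooth (\<lambda>x::real^'n::finite. \<Sum>a\<in>A. f a x)"
  by (induction A rule: infinite_finite_induct) (auto intro: smooth_const smooth_add)

lemma smooth_prod: "(\<And>a. a \<in> A \<Longrightarrow> smooth (f a)) \<Longrightarrow> smooth (\<lambda>x::real^'n::finite. \<Prod>a\<in>A. f a x)"
  by (induction A rule: infinite_finite_induct) (auto intro: smooth_const smooth_mult)

lemma smooth_power: "smooth f \<Longrightarrow> smooth (\<lambda>x::real^'n::finite. f x ^ m)"
  by (induction m) (auto intro: smooth_const smooth_mult)

lemma iter_partial_zero: "iter_partial is (\<lambda>x. 0) = (\<lambda>x. 0)"
  by (induction "is") (auto simp: partial_deriv_const)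

lemma iter_partial_add:
  assumes "smooth f" "smooth g"
  shows "iter_partial is (\<lambda>x. f x + g x) = (\<lambda>x. iter_partial is f x + iter_partial is g x)"
proof (induction "is")
  case (Cons i "is")
  show ?case unfolding iter_partial_Cons Cons
    by (rule ext, rule partial_deriv_add)
       (intro smooth_differentiable smooth_iter_partial assms)+
qed simp

lemma partial_deriv_cmult:
  assumes "f differentiable (at x)"
  shows "partial_deriv i (\<lambda>x. c * f x) x = c * partial_deriv i f x"
  using partial_deriv_mult[OF differentiable_const assms] by (simp add: partial_deriv_const)

lemma iter_partial_cmult:
  assumes "smooth f"
  shows "iter_partial is (\<lambda>x. c * f x) = (\<lambda>x. c * iter_partial is f x)"
proof (induction "is")
  case (Cons i "is")
  show ?case unfolding iter_partial_Cons Cons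
    by (rule ext, rule partial_deriv_cmult)
       (intro smooth_differentiable smooth_iter_partial assms)
qed simp

lemma iter_partial_sum:
  assumes "\<And>a. a \<in> A \<Longrightarrow> smooth (f a)"
  shows "iter_partial is (\<lambda>x::real^'n::finite. \<Sum>a\<in>A. f a x) = (\<lambda>x. \<Sum>a\<in>A. iter_partial is (f a) x)"
  using assms
  by (induction A rule: infinite_finite_induct)
    (simp_all add: iter_partial_zero iter_partial_add smooth_sum)

section \<open>Derivatives of dilated functions\<close>

lemma has_derivative_scale:
  assumes "f differentiable (at (c *\<^sub>R x))"
  shows "((\<lambda>x. f (c *\<^sub>R x)) has_derivative (\<lambda>h. frechet_derivative f (at (c *\<^sub>R x)) (c *\<^sub>R h))) (at x)"
proof -
  have "(f has_derivative frechet_derivative f (at (c *\<^sub>R x))) (at (c *\<^sub>R x))"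
    using assms frechet_derivative_works by blast
  then show ?thesis
    by (rule has_derivative_compose[rotated]) (auto intro!: derivative_eq_intros)
qed

lemma partial_deriv_scale:
  assumes "f differentiable (at (c *\<^sub>R x))"
  shows "partial_deriv i (\<lambda>x. f (c *\<^sub>R x)) x = c * partial_deriv i f (c *\<^sub>R x)"
  using partial_deriv_eq[OF has_derivative_scale[OF assms]] linear_frechet_derivative[OF assms]
  by (simp add: partial_deriv_def linear_cmul)

lemma smooth_scale:
  fixes f :: "real^'n::finite \<Rightarrow> real"
  assumes "smooth f" shows "smooth (\<lambda>x. f (c *\<^sub>R x))"
proof (rule smooth_coinduct[of _ "{\<lambda>x. g (c *\<^sub>R x) |g. smooth g}"])
  show "(\<lambda>x. f (c *\<^sub>R x)) \<in> {\<lambda>x. g (c *\<^sub>R x) |g. smooth g}" using assms by blast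
  show "g differentiable (at x)" if "g \<in> {\<lambda>x. g (c *\<^sub>R x) |g. smooth g}"
    for g :: "real^'n \<Rightarrow> real" and x
    using that has_derivative_scale[OF smooth_differentiable] unfolding differentiable_def by blast
  show "partial_deriv i g \<in> {\<lambda>x. g (c *\<^sub>R x) |g. smooth g}"
    if "g \<in> {\<lambda>x. g (c *\<^sub>R x) |g. smooth g}" for g :: "real^'n \<Rightarrow> real" and i
  proof -
    from that obtain g0 where g: "g = (\<lambda>x. g0 (c *\<^sub>R x))" "smooth g0" by blast
    \<comment> \<open>The chain rule factor \<open>c\<close> is absorbed into the smooth function,
      which keeps the class stable.\<close>
    then have "partial_deriv i g = (\<lambda>x. (\<lambda>y. c * partial_deriv i g0 y) (c *\<^sub>R x))"
      unfolding g(1) by (intro ext partial_deriv_scale smooth_differentiable g(2))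
    moreover have "smooth (\<lambda>y. c * partial_deriv i g0 y)"
      by (intro smooth_mult smooth_const smooth_partial_deriv g)
    ultimately show ?thesis
      by (intro CollectI exI[of _ "\<lambda>y. c * partial_deriv i g0 y"]) simp
  qed
qed

text \<open>Each derivative contributes one factor \<open>c\<close>; with c = 1/h this is the origin
  of h^(-k).\<close>

lemma iter_partial_scale:
  fixes f :: "real^'n::finite \<Rightarrow> real"
  assumes "smooth f"
  shows "iter_partial is (\<lambda>x. f (c *\<^sub>R x)) = (\<lambda>x. c ^ length is * iter_partial is f (c *\<^sub>R x))"
proof (induction "is")
  case (Cons i "is")
  have "smooth (iter_partial is f)" using assms by (rule smooth_iter_partial)
  then have "partial_deriv i (\<lambda>x. c ^ length is * iter_partial is f (c *\<^sub>R x)) x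
      = c ^ length is * (c * partial_deriv i (iter_partial is f) (c *\<^sub>R x))" for x
    by (subst partial_deriv_cmult)
       (simp_all add: smooth_differentiable smooth_scale partial_deriv_scale)
  then show ?case unfolding iter_partial_Cons Cons by auto
qed simp

subsection \<open>Symmetry of mixed partial derivatives\<close>

lemma smooth_DERIV_line:
  fixes f :: "real^'n::finite \<Rightarrow> real"
  assumes "smooth f"
  shows "((\<lambda>t. f (x + t *\<^sub>R axis i 1)) has_real_derivative partial_deriv i f (x + t *\<^sub>R axis i 1)) (at t)"
proof -
  let ?y = "x + t *\<^sub>R axis i 1"
  have "((\<lambda>t. f (x + t *\<^sub>R axis i 1)) has_derivative
      (\<lambda>h. frechet_derivative f (at ?y) (h *\<^sub>R axis i 1))) (at t)"
    by (rule has_derivative_compose[OF _ smooth_has_derivative[OF assms]])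
       (auto intro!: derivative_eq_intros)
  moreover have "frechet_derivative f (at ?y) (h *\<^sub>R axis i 1) = partial_deriv i f ?y * h" for h
    using linear_frechet_derivative[OF smooth_differentiable[OF assms]]
    by (simp add: partial_deriv_def linear_cmul)
  ultimately show ?thesis
    by (simp add: has_field_derivative_def)
qed

text \<open>Two applications of the mean value theorem, first along \<open>i\<close>, then along
  \<open>j\<close>. The left-hand side is symmetric in \<open>i\<close> and \<open>j\<close> while
  the right-hand side is not visibly so; this asymmetry is exploited next.\<close>

lemma second_difference_mean_value:
  fixes f :: "real^'n::finite \<Rightarrow> real"
  assumes f: "smooth f" and t: "t > 0"
  shows "\<exists>y. dist y x \<le> 2 * t \<and>
    f (x + t *\<^sub>R axis i 1 + t *\<^sub>R axis j 1) - f (x + t *\<^sub>R axis i 1) - f (x + t *\<^sub>R axis j 1) + f x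
      = t^2 * partial_deriv j (partial_deriv i f) y"
proof -
  \<comment> \<open>The increment along \<open>j\<close>, as a function of the displacement along
    \<open>i\<close>; its own increment is the second difference.\<close>
  define g where "g s = f (x + t *\<^sub>R axis j 1 + s *\<^sub>R axis i 1) - f (x + s *\<^sub>R axis i 1)" for s
  have "(g has_real_derivative partial_deriv i f (x + t *\<^sub>R axis j 1 + s *\<^sub>R axis i 1)
      - partial_deriv i f (x + s *\<^sub>R axis i 1)) (at s)" for s
    unfolding g_def by (intro DERIV_diff smooth_DERIV_line f)
  from MVT2[OF t this] obtain s where s: "0 < s" "s < t" and gs: "g t - g 0 =
    (t - 0) * (partial_deriv i f (x + t *\<^sub>R axis j 1 + s *\<^sub>R axis i 1)
      - partial_deriv i f (x + s *\<^sub>R axis i 1))"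
    by blast
  define p where "p r = partial_deriv i f ((x + s *\<^sub>R axis i 1) + r *\<^sub>R axis j 1)" for r
  have "(p has_real_derivative
      partial_deriv j (partial_deriv i f) ((x + s *\<^sub>R axis i 1) + r *\<^sub>R axis j 1)) (at r)" for r
    unfolding p_def by (intro smooth_DERIV_line smooth_partial_deriv f)
  from MVT2[OF t this] obtain r where r: "0 < r" "r < t" and pr: "p t - p 0 =
    (t - 0) * partial_deriv j (partial_deriv i f) ((x + s *\<^sub>R axis i 1) + r *\<^sub>R axis j 1)"
    by blast
  let ?y = "(x + s *\<^sub>R axis i 1) + r *\<^sub>R axis j 1"
  have "dist ?y x \<le> norm (s *\<^sub>R axis i (1::real) :: real^'n) + norm (r *\<^sub>R axis j (1::real) :: real^'n)"
    unfolding dist_norm by (metis (no_types, lifting) add.assoc add_diff_cancel_left' norm_triangle_ineq)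
  also have "\<dots> \<le> 2 * t" using s r by simp
  finally have "dist ?y x \<le> 2 * t" .
  moreover have "g t - g 0 = t * (p t - p 0)" unfolding gs p_def by (simp add: add_ac)
  then have "g t - g 0 = t^2 * partial_deriv j (partial_deriv i f) ?y"
    unfolding pr by (simp add: power2_eq_square)
  moreover have "g t - g 0 = f (x + t *\<^sub>R axis i 1 + t *\<^sub>R axis j 1) - f (x + t *\<^sub>R axis i 1)
      - f (x + t *\<^sub>R axis j 1) + f x"
    unfolding g_def by (simp add: add_ac)
  ultimately show ?thesis by auto
qed

text \<open>Swapping \<open>i\<close> and \<open>j\<close> leaves the second difference unchanged,
  so the two mixed derivatives agree at points within 2t of \<open>x\<close>, though perhaps at
  different ones. Continuity closes the gap as t tends to 0.\<close>

lemma partial_deriv_commute: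
  fixes f :: "real^'n::finite \<Rightarrow> real"
  assumes f: "smooth f"
  shows "partial_deriv i (partial_deriv j f) = partial_deriv j (partial_deriv i f)"
proof
  fix x
  let ?a = "partial_deriv i (partial_deriv j f)" and ?b = "partial_deriv j (partial_deriv i f)"
  define t where "t m = inverse (real (Suc m))" for m
  have t: "t m > 0" for m by (simp add: t_def)
  have t0: "t \<longlonglongrightarrow> 0" unfolding t_def by (rule LIMSEQ_inverse_real_of_nat)
  have "\<exists>y z. dist y x \<le> 2 * t m \<and> dist z x \<le> 2 * t m \<and> ?b y = ?a z" for m
  proof -
    obtain y where y: "dist y x \<le> 2 * t m"
      "f (x + t m *\<^sub>R axis i 1 + t m *\<^sub>R axis j 1) - f (x + t m *\<^sub>R axis i 1)
        - f (x + t m *\<^sub>R axis j 1) + f x = (t m)^2 * ?b y"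
      using second_difference_mean_value[OF f t[of m], of x i j] by blast
    obtain z where z: "dist z x \<le> 2 * t m"
      "f (x + t m *\<^sub>R axis j 1 + t m *\<^sub>R axis i 1) - f (x + t m *\<^sub>R axis j 1)
        - f (x + t m *\<^sub>R axis i 1) + f x = (t m)^2 * ?a z"
      using second_difference_mean_value[OF f t[of m], of x j i] by blast
    have "(t m)^2 * ?b y = (t m)^2 * ?a z"
      unfolding y(2)[symmetric] z(2)[symmetric] by (simp add: algebra_simps)
    with t[of m] have "?b y = ?a z" by simp
    with y z show ?thesis by blast
  qed
  then obtain y z where y: "\<And>m. dist (y m) x \<le> 2 * t m" and z: "\<And>m. dist (z m) x \<le> 2 * t m"
    and eq: "\<And>m. ?b (y m) = ?a (z m)"
    by metis
  have lim: "w \<longlonglongrightarrow> x" if "\<And>m. dist (w m) x \<le> 2 * t m" for w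
  proof -
    have "(\<lambda>m. 2 * t m) \<longlonglongrightarrow> 0" using tendsto_mult_right_zero[OF t0] .
    then have "(\<lambda>m. dist (w m) x) \<longlonglongrightarrow> 0"
      by (rule Lim_null_comparison[rotated]) (simp add: that)
    then show ?thesis by (rule tendsto_dist_iff[THEN iffD2])
  qed
  have cont: "isCont ?a x" "isCont ?b x"
    using f by (auto intro!: differentiable_imp_continuous_within smooth_differentiable smooth_partial_deriv)
  have "(\<lambda>m. ?b (y m)) \<longlonglongrightarrow> ?b x" "(\<lambda>m. ?a (z m)) \<longlonglongrightarrow> ?a x"
    by (rule isCont_tendsto_compose[OF cont(2) lim[OF y]], rule isCont_tendsto_compose[OF cont(1) lim[OF z]])
  then show "?a x = ?b x"
    using eq LIMSEQ_unique by auto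
qed

lemma iter_partial_partial_commute:
  assumes "smooth f"
  shows "iter_partial is (partial_deriv i f) = partial_deriv i (iter_partial is f)"
proof (induction "is")
  case (Cons j "is")
  show ?case unfolding iter_partial_Cons Cons
    by (rule partial_deriv_commute) (rule smooth_iter_partial[OF assms])
qed simp

text \<open>The head of one list is located in the other and pulled to the front by
  commutation.\<close>

lemma iter_partial_perm:
  assumes "smooth f" "mset is = mset js"
  shows "iter_partial is f = iter_partial js f"
  using assms(2)
proof (induction "is" arbitrary: js)
  case (Cons i "is")
  then have "i \<in> set js" by (metis list.set_intros(1) mset_eq_setD)
  then obtain xs ys where js: "js = xs @ i # ys" by (meson split_list)
  with Cons have "iter_partial is f = iter_partial (xs @ ys) f" by simp
  then show ?case
    by (simp add: js iter_partial_append iter_partial_partial_commute smooth_iter_partial assms)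
qed simp

lemma D_eq_iter_partial:
  assumes "smooth f" "\<And>i. count_list is i = \<sigma> i"
  shows "D \<sigma> f = iter_partial is f"
proof -
  define js where "js = (SOME is. \<forall>i. count_list is i = \<sigma> i)"
  have "\<forall>i. count_list js i = \<sigma> i"
    unfolding js_def by (rule someI[of _ "is"]) (use assms in blast)
  then have "mset is = mset js" using assms(2) by (simp add: multiset_eq_iff flip: count_mset)
  then show ?thesis unfolding D_def js_def[symmetric] by (metis iter_partial_perm assms(1))
qed

text \<open>One list serves all smooth functions simultaneously, so \<open>D\<close> of a function
  and of a test function can be unfolded along the same list.\<close>

lemma obtain_D_list:
  obtains "is" where "\<And>i. count_list is i = \<sigma> i" "length is = mi_order \<sigma>"
    "\<And>f. smooth f \<Longrightarrow> D \<sigma> f = iter_partial is f"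
proof -
  obtain "is" where *: "\<And>i. count_list is i = \<sigma> i" using ex_list_of_multi_index by blast
  have "length is = (\<Sum>i\<in>set is. count_list is i)"
    by (metis sum_count_set order_refl finite_set)
  also have "\<dots> = (\<Sum>i\<in>UNIV. count_list is i)"
    by (rule sum.mono_neutral_left) (auto simp: count_list_0_iff)
  finally have "length is = mi_order \<sigma>" by (simp add: * mi_order_def)
  with * that show ?thesis using D_eq_iter_partial by blast
qed

text \<open>The list for \<sigma> concatenated with itself has the counts of 2\<sigma>. This links
  the weak formulation to the operator in \<open>is_calL\<close>.\<close>

lemma D_D:
  assumes "smooth f" shows "D \<sigma> (D \<sigma> f) = D (\<lambda>i. 2 * \<sigma> i) f"
proof -
  obtain "is" where l: "\<And>i. count_list is i = \<sigma> i" "\<And>f. smooth f \<Longrightarrow> D \<sigma> f = iter_partial is f"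
    by (metis obtain_D_list)
  have "D (\<lambda>i. 2 * \<sigma> i) f = iter_partial (is @ is) f"
    by (rule D_eq_iter_partial[OF assms]) (simp add: l(1))
  then show ?thesis
    by (simp add: l(2) assms iter_partial_append smooth_iter_partial)
qed

section \<open>Bump functions\<close>

text \<open>The classical functions P(1/t) exp(-1/t), extended by zero. Carrying the polynomial P as
  a parameter makes the family closed under differentiation.\<close>

definition flat :: "real poly \<Rightarrow> real \<Rightarrow> real" where
  "flat p t = (if t \<le> 0 then 0 else poly p (inverse t) * exp (- inverse t))"

text \<open>With y = 1/t, exponential decay beats every power of y.\<close>

lemma flat_tendsto_0: "(flat p \<longlongrightarrow> 0) (at 0)"
proof (rule filterlim_split_at)
  have "\<forall>\<^sub>F t in at_left 0. 0 = flat p t"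
    by (auto simp: flat_def eventually_at_filter)
  then show "(flat p \<longlongrightarrow> 0) (at_left 0)"
    by (rule Lim_transform_eventually[OF tendsto_const])
  have "((\<lambda>y. \<Sum>k\<le>degree p. coeff p k * (y ^ k / exp y)) \<longlongrightarrow> (\<Sum>k\<le>degree p. coeff p k * 0)) at_top"
    by (intro tendsto_sum tendsto_mult tendsto_const tendsto_power_div_exp_0)
  then have "((\<lambda>y. poly p y * exp (- y)) \<longlongrightarrow> 0) at_top"
    by (simp add: poly_altdef sum_distrib_right exp_minus divide_inverse mult.assoc)
  then have "((\<lambda>t. poly p (inverse t) * exp (- inverse t)) \<longlongrightarrow> 0) (at_right 0)"
    by (rule filterlim_compose[OF _ filterlim_inverse_at_top_right])
  moreover have "\<forall>\<^sub>F t in at_right 0. poly p (inverse t) * exp (- inverse t) = flat p t"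
    by (auto simp: flat_def eventually_at_filter)
  ultimately show "(flat p \<longlongrightarrow> 0) (at_right 0)"
    by (rule Lim_transform_eventually)
qed

text \<open>In y = 1/t the derivative is y^2 (P - P')(y) exp(-y), since dy/dt = -y^2;
  \<open>[:0, 0, 1:]\<close> is the polynomial y^2.\<close>

lemma DERIV_flat:
  "(flat p has_real_derivative flat ([:0, 0, 1:] * (p - pderiv p)) t) (at t)"
proof -
  consider "t < 0" | "t = 0" | "t > 0" by linarith
  then show ?thesis
  proof cases
    case 1
    have "((\<lambda>_. 0) has_real_derivative 0) (at t)" by simp
    then have "(flat p has_real_derivative 0) (at t)"
      by (rule has_field_derivative_transform_within_open[of _ _ _ "{..<0}"])
         (use 1 in \<open>auto simp: flat_def\<close>)
    with 1 show ?thesis by (simp add: flat_def)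
  next
    case 2
    \<comment> \<open>Dividing by h multiplies the polynomial in 1/h by its variable, so the
      quotient is again in the family and tends to 0.\<close>
    have "(\<lambda>h. (flat p (0 + h) - flat p 0) / h) = flat (pCons 0 p)"
      by (auto simp: flat_def fun_eq_iff field_simps)
    with 2 show ?thesis
      using flat_tendsto_0[of "pCons 0 p"] by (simp add: DERIV_def) (simp add: flat_def)
  next
    case 3
    have "((\<lambda>t. poly p (inverse t) * exp (- inverse t)) has_real_derivative
        flat ([:0, 0, 1:] * (p - pderiv p)) t) (at t)"
      using 3 by (auto intro!: derivative_eq_intros DERIV_chain2[OF poly_DERIV]
          simp: flat_def field_simps power2_eq_square)
    then show ?thesis
      by (rule has_field_derivative_transform_within_open[of _ _ _ "{0<..}"])
         (use 3 in \<open>auto simp: flat_def\<close>)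
  qed
qed

lemma smooth_flat_affine:
  "smooth (\<lambda>x::real^'n::finite. flat p (c * x $ i + b))"
proof (rule smooth_coinduct[of _ "range (\<lambda>p x. flat p (c * x $ i + b))"])
  show "(\<lambda>x::real^'n. flat p (c * x $ i + b)) \<in> range (\<lambda>p x. flat p (c * x $ i + b))" by blast
  have der: "((\<lambda>x::real^'n. flat p (c * x $ i + b)) has_derivative
      (\<lambda>h. flat ([:0, 0, 1:] * (p - pderiv p)) (c * x $ i + b) * (c * h $ i))) (at x)" for p x
  proof (rule has_derivative_compose[where f = "\<lambda>x. c * x $ i + b" and f' = "\<lambda>h. c * h $ i"])
    show "((\<lambda>x::real^'n. c * x $ i + b) has_derivative (\<lambda>h. c * h $ i)) (at x)"
      by (auto intro!: derivative_eq_intros bounded_linear_imp_has_derivative)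
  qed (use DERIV_flat in \<open>simp add: has_field_derivative_def\<close>)
  then show "g differentiable (at x)" if "g \<in> range (\<lambda>p x. flat p (c * x $ i + b))"
    for g :: "real^'n \<Rightarrow> real" and x
    using that unfolding differentiable_def by blast
  show "partial_deriv j g \<in> range (\<lambda>p x. flat p (c * x $ i + b))"
    if g: "g \<in> range (\<lambda>p x. flat p (c * x $ i + b))" for g :: "real^'n \<Rightarrow> real" and j
  proof -
    obtain p where p: "g = (\<lambda>x. flat p (c * x $ i + b))" using g by blast
    \<comment> \<open>The inner derivative in direction \<open>j\<close> is \<open>c\<close> or 0,
      and this constant goes into the polynomial.\<close>
    define q where "q = smult (if j = i then c else 0) ([:0, 0, 1:] * (p - pderiv p))"
    have "partial_deriv j g x = flat q (c * x $ i + b)" for x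
      unfolding p partial_deriv_eq[OF der] q_def by (simp add: axis_def flat_def)
    then show ?thesis by blast
  qed
qed

text \<open>For m > 0 a smooth function positive exactly on the open box. The parameter
  \<open>m\<close> controls steepness: m tending to infinity recovers the indicator, while a fixed
  \<open>m\<close> gives the cut-off of the main proof.\<close>

definition box_bump :: "real^'n \<Rightarrow> real^'n \<Rightarrow> real \<Rightarrow> real^'n::finite \<Rightarrow> real" where
  "box_bump a b m x = (\<Prod>i\<in>UNIV. flat 1 (m * (x $ i - a $ i)) * flat 1 (m * (b $ i - x $ i)))"

lemma flat_1: "flat 1 t = (if t \<le> 0 then 0 else exp (- inverse t))"
  by (simp add: flat_def)

lemma flat_1_bounds: "0 \<le> flat 1 t" "flat 1 t \<le> 1"
  by (auto simp: flat_1 not_le)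

lemma flat_1_eq_0_iff: "flat 1 t = 0 \<longleftrightarrow> t \<le> 0"
  by (simp add: flat_1)

lemma smooth_box_bump:
  fixes a b :: "real^'n::finite"
  shows "smooth (box_bump a b m)"
proof -
  have "smooth (\<lambda>x::real^'n. flat 1 (m * x $ i + (- m * a $ i)))"
    "smooth (\<lambda>x::real^'n. flat 1 (- m * x $ i + m * b $ i))" for i
    by (rule smooth_flat_affine)+
  then show ?thesis
    unfolding box_bump_def[abs_def] by (intro smooth_prod smooth_mult) (simp_all add: algebra_simps)
qed

lemma box_bump_bounds: "0 \<le> box_bump a b m x" "box_bump a b m x \<le> 1"
  unfolding box_bump_def
  by (auto intro!: prod_nonneg prod_le_1 mult_le_one mult_nonneg_nonneg flat_1_bounds)

lemma box_bump_eq_0_iff: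
  assumes "m > 0" shows "box_bump a b m x = 0 \<longleftrightarrow> x \<notin> box a b"
proof -
  have "flat 1 (m * t) = 0 \<longleftrightarrow> t \<le> 0" for t
    using assms by (simp add: flat_1_eq_0_iff mult_le_0_iff)
  then show ?thesis by (auto simp: box_bump_def mem_box_cart not_less)
qed

lemma box_bump_test_function:
  assumes "m > 0" "cbox a b \<subseteq> \<Omega>"
  shows "box_bump a b m \<in> test_functions \<Omega>"
proof -
  have "closure {x. box_bump a b m x \<noteq> 0} \<subseteq> cbox a b"
    by (rule closure_minimal) (use assms(1) box_subset_cbox in \<open>auto simp: box_bump_eq_0_iff\<close>)
  moreover from this have "compact (closure {x. box_bump a b m x \<noteq> 0})"
    using bounded_subset[OF bounded_cbox] by (simp add: compact_eq_bounded_closed)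
  ultimately show ?thesis
    using assms(2) by (auto simp: test_functions_def smooth_box_bump)
qed

text \<open>Inside the box every factor has the form exp(-1/(m c)) with c > 0 and tends to 1;
  outside, the product is 0 for all these \<open>m\<close>.\<close>

lemma box_bump_tendsto_indicator:
  "(\<lambda>m. box_bump a b (real (Suc m)) x) \<longlonglongrightarrow> indicator (box a b) x"
proof (cases "x \<in> box a b")
  case True
  have lim: "(\<lambda>m. flat 1 (real (Suc m) * c)) \<longlonglongrightarrow> 1" if "c > 0" for c
  proof -
    have "(\<lambda>m. exp (- (inverse (real (Suc m)) * inverse c))) \<longlonglongrightarrow> exp (- (0 * inverse c))"
      by (intro tendsto_intros LIMSEQ_inverse_real_of_nat)
    then show ?thesis using that by (simp add: flat_1 mult_le_0_iff not_le del: of_nat_Suc)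
  qed
  have "(\<lambda>m. box_bump a b (real (Suc m)) x) \<longlonglongrightarrow> (\<Prod>i\<in>(UNIV::'a set). 1 * 1)"
    unfolding box_bump_def
    by (intro tendsto_prod tendsto_mult lim) (use True in \<open>auto simp: mem_box_cart\<close>)
  then show ?thesis using True by simp
next
  case False
  then have "box_bump a b (real (Suc m)) x = 0" for m by (simp add: box_bump_eq_0_iff)
  with False show ?thesis by simp
qed

section \<open>The fundamental lemma of the calculus of variations\<close>

lemma test_functions_continuous:
  fixes \<phi> :: "real^'n::finite \<Rightarrow> real"
  shows "\<phi> \<in> test_functions \<Omega> \<Longrightarrow> continuous_on A \<phi>"
  by (auto simp: test_functions_def intro: smooth_continuous_on)

lemma test_functions_outside: "\<phi> \<in> test_functions \<Omega> \<Longrightarrow> x \<notin> \<Omega> \<Longrightarrow> \<phi> x = 0"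
proof (rule ccontr)
  assume "\<phi> \<in> test_functions \<Omega>" "x \<notin> \<Omega>" "\<phi> x \<noteq> 0"
  moreover from this have "x \<in> closure {x. \<phi> x \<noteq> 0}"
    by (intro subsetD[OF closure_subset]) simp
  ultimately show False by (auto simp: test_functions_def)
qed

lemma test_functions_borel:
  fixes \<phi> :: "real^'n::finite \<Rightarrow> real"
  shows "\<phi> \<in> test_functions \<Omega> \<Longrightarrow> \<phi> \<in> borel_measurable borel"
  by (intro borel_measurable_continuous_onI test_functions_continuous)

text \<open>The test function vanishes off \<Omega>, so arbitrary values of \<open>g\<close> there
  do no harm.\<close>

lemma lebesgue_on_test_function:
  fixes \<phi> g :: "real^'n::finite \<Rightarrow> real"
  assumes "open \<Omega>" "\<phi> \<in> test_functions \<Omega>"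
  shows "(LINT x|lebesgue_on \<Omega>. g x * \<phi> x) = (LINT x|lebesgue. g x * \<phi> x)"
    and "integrable (lebesgue_on \<Omega>) (\<lambda>x. g x * \<phi> x) \<longleftrightarrow> integrable lebesgue (\<lambda>x. g x * \<phi> x)"
proof -
  have "\<Omega> \<in> sets lebesgue" using assms(1) by auto
  moreover have "(\<lambda>x. indicator \<Omega> x *\<^sub>R (g x * \<phi> x)) = (\<lambda>x. g x * \<phi> x)"
    using test_functions_outside[OF assms(2)] by (auto simp: fun_eq_iff indicator_def)
  ultimately show "(LINT x|lebesgue_on \<Omega>. g x * \<phi> x) = (LINT x|lebesgue. g x * \<phi> x)"
    "integrable (lebesgue_on \<Omega>) (\<lambda>x. g x * \<phi> x) \<longleftrightarrow> integrable lebesgue (\<lambda>x. g x * \<phi> x)"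
    by (simp_all add: integral_restrict_space integrable_restrict_space)
qed

text \<open>The indicator of a box is not a test function but is a bounded pointwise limit of test
  functions, so orthogonality passes to it by dominated convergence.\<close>

lemma integral_cbox_eq_0:
  fixes g :: "real^'n::finite \<Rightarrow> real"
  assumes \<Omega>: "open \<Omega>" and g: "locally_integrable \<Omega> g"
    and orth: "\<And>\<phi>. \<phi> \<in> test_functions \<Omega> \<Longrightarrow> (LINT x|lebesgue_on \<Omega>. g x * \<phi> x) = 0"
    and ab: "cbox a b \<subseteq> \<Omega>"
  shows "integral (cbox a b) g = 0"
proof -
  \<comment> \<open>Truncation turns the merely locally integrable \<open>g\<close> into an
    integrable dominating function.\<close>
  define G where "G x = indicator (cbox a b) x * g x" for x
  have "set_integrable lebesgue (cbox a b) g"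
    using g ab by (auto simp: locally_integrable_def)
  then have G: "integrable lebesgue G" by (simp add: set_integrable_def G_def[abs_def])
  define \<phi> where "\<phi> m = box_bump a b (real (Suc m))" for m
  have \<phi>: "\<phi> m \<in> test_functions \<Omega>" for m
    unfolding \<phi>_def using ab by (intro box_bump_test_function) auto
  have bd: "0 \<le> \<phi> m x" "\<phi> m x \<le> 1" for m x
    unfolding \<phi>_def by (rule box_bump_bounds)+
  have out: "\<phi> m x = 0" if "x \<notin> box a b" for m x
    using that by (simp add: \<phi>_def box_bump_eq_0_iff)
  have "(\<lambda>x. G x * \<phi> m x) = (\<lambda>x. g x * \<phi> m x)" for m
    using out[of _ m] box_subset_cbox[of a b] by (auto simp: fun_eq_iff G_def indicator_def)
  then have zero: "(LINT x|lebesgue. G x * \<phi> m x) = 0" for m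
    using orth[OF \<phi>[of m]] by (simp only: lebesgue_on_test_function(1)[OF \<Omega> \<phi>])
  have "(\<lambda>m. LINT x|lebesgue. G x * \<phi> m x) \<longlonglongrightarrow> (LINT x|lebesgue. G x * indicator (box a b) x)"
  proof (rule integral_dominated_convergence[where w = "\<lambda>x. \<bar>G x\<bar>"])
    show "(\<lambda>x. G x * indicator (box a b) x) \<in> borel_measurable lebesgue"
      using G by (intro borel_measurable_times borel_measurable_indicator) auto
    show "(\<lambda>x. G x * \<phi> m x) \<in> borel_measurable lebesgue" for m
      using G test_functions_borel[OF \<phi>[of m]]
      by (intro borel_measurable_times) (auto intro: measurable_completion)
    show "AE x in lebesgue. (\<lambda>m. G x * \<phi> m x) \<longlonglongrightarrow> G x * indicator (box a b) x"
      unfolding \<phi>_def by (intro AE_I2 tendsto_mult tendsto_const box_bump_tendsto_indicator)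
    show "AE x in lebesgue. norm (G x * \<phi> m x) \<le> \<bar>G x\<bar>" for m
      using bd by (intro AE_I2) (simp add: abs_mult mult_left_le)
  qed (use G in auto)
  then have "(LINT x|lebesgue. G x * indicator (box a b) x) = 0"
    by (simp add: zero LIMSEQ_const_iff)
  moreover have "G x * indicator (box a b) x = indicator (box a b) x *\<^sub>R g x" for x
    using box_subset_cbox[of a b] by (auto simp: G_def indicator_def)
  ultimately have "(LINT x:box a b|lebesgue. g x) = 0"
    by (simp add: set_lebesgue_integral_def)
  moreover have "set_integrable lebesgue (box a b) g"
    by (rule set_integrable_subset[OF \<open>set_integrable lebesgue (cbox a b) g\<close> _ box_subset_cbox]) auto
  ultimately show ?thesis
    by (simp add: set_lebesgue_integral_eq_integral(2) integral_open_interval)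
qed

text \<open>Lebesgue differentiation: at almost every point the averages over shrinking cubes with
  lower corner there converge to the value, and here all these averages are 0.\<close>

lemma negligible_nonzero_box:
  fixes g :: "real^'n::finite \<Rightarrow> real"
  assumes g: "g absolutely_integrable_on cbox a b"
    and zero: "\<And>c d. cbox c d \<subseteq> cbox a b \<Longrightarrow> integral (cbox c d) g = 0"
  shows "negligible {x \<in> cbox a b. g x \<noteq> 0}"
proof -
  define f where "f x = (if x \<in> cbox a b then g x else 0)" for x
  have "f integrable_on UNIV"
    using g unfolding f_def[abs_def] integrable_restrict_UNIV
    by (simp add: set_lebesgue_integral_eq_integral(1))
  then have "f integrable_on cbox c d" for c d by (rule integrable_on_subcbox) simp
  from integrable_ccontinuous_explicit[OF this] obtain N where N: "negligible N"
    "\<And>x e. \<lbrakk>x \<notin> N; 0 < e\<rbrakk> \<Longrightarrow> \<exists>d>0. \<forall>h. 0 < h \<and> h < d \<longrightarrow>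
      norm (integral (cbox x (x + h *\<^sub>R One)) f /\<^sub>R h ^ DIM(real^'n) - f x) < e"
    by metis
  have "g x = 0" if x: "x \<in> box a b" "x \<notin> N" for x
  proof (rule ccontr)
    assume "g x \<noteq> 0"
    then have "0 < norm (g x)" by simp
    from N(2)[OF x(2) this] obtain d where d: "d > 0" "\<And>h. 0 < h \<Longrightarrow> h < d \<Longrightarrow>
        norm (integral (cbox x (x + h *\<^sub>R One)) f /\<^sub>R h ^ DIM(real^'n) - f x) < norm (g x)"
      by blast
    \<comment> \<open>The distance to the upper faces: a cube of side at most \<open>r\<close> with
      lower corner \<open>x\<close> stays in the box.\<close>
    define r where "r = Min (range (\<lambda>i. b $ i - x $ i))"
    have "r > 0" unfolding r_def using x(1) by (auto simp: mem_box_cart)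
    define h where "h = min r (d / 2)"
    have h: "0 < h" "h < d" "h \<le> r" using \<open>r > 0\<close> d(1) by (auto simp: h_def)
    have "h \<le> b $ i - x $ i" for i
      using h(3) Min_le[of "range (\<lambda>i. b $ i - x $ i)" "b $ i - x $ i"] by (auto simp: r_def)
    moreover have "One $ i = (1::real)" for i :: 'n
      using inner_sum_left_Basis[of "axis i (1::real)" "\<lambda>_. 1"] unfolding cart_eq_inner_axis by simp
    ultimately have "a $ i \<le> x $ i" "(x + h *\<^sub>R One) $ i \<le> b $ i" for i
      using x(1) by (auto simp: mem_box_cart less_imp_le algebra_simps)
    then have sub: "cbox x (x + h *\<^sub>R One) \<subseteq> cbox a b"
      unfolding mem_box_cart subset_iff by (meson order_trans)
    have "integral (cbox x (x + h *\<^sub>R One)) f = integral (cbox x (x + h *\<^sub>R One)) g"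
      by (rule integral_cong) (use sub in \<open>auto simp: f_def\<close>)
    then have "integral (cbox x (x + h *\<^sub>R One)) f = 0" using zero[OF sub] by simp
    moreover have "f x = g x" using x(1) box_subset_cbox by (auto simp: f_def)
    ultimately show False using d(2)[OF h(1,2)] by simp
  qed
  then have "{x \<in> cbox a b. g x \<noteq> 0} \<subseteq> N \<union> (cbox a b - box a b)" by blast
  then show ?thesis
    using N(1) negligible_frontier_interval negligible_Un negligible_subset by blast
qed

text \<open>An open set is a countable union of closed boxes, so it suffices that the exceptional
  set in each box is null.\<close>

theorem fundamental_lemma:
  fixes g :: "real^'n::finite \<Rightarrow> real"
  assumes \<Omega>: "open \<Omega>" and g: "locally_integrable \<Omega> g"
    and orth: "\<And>\<phi>. \<phi> \<in> test_functions \<Omega> \<Longrightarrow> (LINT x|lebesgue_on \<Omega>. g x * \<phi> x) = 0"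
  shows "AE x in lebesgue_on \<Omega>. g x = 0"
proof -
  obtain \<D> where D: "countable \<D>" "\<D> \<subseteq> Pow \<Omega>" "\<And>X. X \<in> \<D> \<Longrightarrow> \<exists>a b. X = cbox a b" "\<Union>\<D> = \<Omega>"
    by (rule open_countable_Union_open_cbox[OF \<Omega>]) blast
  have "negligible {x \<in> X. g x \<noteq> 0}" if X: "X \<in> \<D>" for X
  proof -
    obtain a b where ab: "X = cbox a b" using D(3)[OF X] by blast
    have sub: "cbox a b \<subseteq> \<Omega>" using X D(2) ab by blast
    show ?thesis unfolding ab
    proof (rule negligible_nonzero_box)
      show "g absolutely_integrable_on cbox a b"
        using g sub by (auto simp: locally_integrable_def)
      show "integral (cbox c d) g = 0" if "cbox c d \<subseteq> cbox a b" for c d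
        using integral_cbox_eq_0[OF \<Omega> g orth] that sub by blast
    qed
  qed
  then have "negligible (\<Union>((\<lambda>X. {x \<in> X. g x \<noteq> 0}) ` \<D>))"
    using D(1) by (intro negligible_countable_Union) auto
  moreover have "\<Union>((\<lambda>X. {x \<in> X. g x \<noteq> 0}) ` \<D>) = {x. \<not> (x \<in> \<Omega> \<longrightarrow> g x = 0)}"
    using D(4) by blast
  ultimately have "{x. \<not> (x \<in> \<Omega> \<longrightarrow> g x = 0)} \<in> null_sets lebesgue"
    by (simp add: negligible_iff_null_sets)
  then have "AE x in lebesgue. x \<in> \<Omega> \<longrightarrow> g x = 0"
    by (rule AE_I') auto
  moreover have "\<Omega> \<inter> space lebesgue \<in> sets lebesgue" using \<Omega> by auto
  ultimately show ?thesis by (subst AE_restrict_space_iff)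
qed

section \<open>Integration by parts\<close>

lemma test_functions_smooth: "\<phi> \<in> test_functions \<Omega> \<Longrightarrow> smooth \<phi>"
  by (simp add: test_functions_def)

text \<open>The closure in the hypothesis matters for derivatives, which may be nonzero at points
  where \<phi> itself vanishes.\<close>

lemma test_functionsI:
  fixes f :: "real^'n::finite \<Rightarrow> real"
  assumes "\<phi> \<in> test_functions \<Omega>" "smooth f" "{x. f x \<noteq> 0} \<subseteq> closure {x. \<phi> x \<noteq> 0}"
  shows "f \<in> test_functions \<Omega>"
proof -
  have "closure {x. f x \<noteq> 0} \<subseteq> closure {x. \<phi> x \<noteq> 0}"
    using assms(3) by (rule closure_minimal) simp
  moreover from this have "compact (closure {x. f x \<noteq> 0})"
    using assms(1) bounded_subset unfolding test_functions_def compact_eq_bounded_closed by blast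
  ultimately show ?thesis
    using assms(1,2) unfolding test_functions_def by blast
qed

lemma test_functions_partial_deriv:
  fixes \<phi> :: "real^'n::finite \<Rightarrow> real"
  assumes "\<phi> \<in> test_functions \<Omega>"
  shows "partial_deriv i \<phi> \<in> test_functions \<Omega>"
proof (rule test_functionsI[OF assms])
  show "smooth (partial_deriv i \<phi>)"
    using assms by (intro smooth_partial_deriv test_functions_smooth)
  show "{x. partial_deriv i \<phi> x \<noteq> 0} \<subseteq> closure {x. \<phi> x \<noteq> 0}"
  proof
    fix x assume x: "x \<in> {x. partial_deriv i \<phi> x \<noteq> 0}"
    show "x \<in> closure {x. \<phi> x \<noteq> 0}"
    proof (rule ccontr)
      assume "x \<notin> closure {x. \<phi> x \<noteq> 0}"
      then have x': "x \<in> - closure {x. \<phi> x \<noteq> 0}" by simp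
      have eq: "0 = \<phi> y" if "y \<in> - closure {x. \<phi> x \<noteq> 0}" for y
        using that closure_subset[of "{x. \<phi> x \<noteq> 0}"] by auto
      have "(\<phi> has_derivative (\<lambda>h. 0)) (at x)"
        by (rule has_derivative_transform_within_open[OF has_derivative_const open_Compl[OF closed_closure] x' eq])
      from partial_deriv_eq[OF this] show False using x by simp
    qed
  qed
qed

lemma test_functions_iter_partial:
  fixes \<phi> :: "real^'n::finite \<Rightarrow> real"
  shows "\<phi> \<in> test_functions \<Omega> \<Longrightarrow> iter_partial is \<phi> \<in> test_functions \<Omega>"
  by (induction "is") (auto intro: test_functions_partial_deriv)

lemma test_functions_D:
  fixes \<phi> :: "real^'n::finite \<Rightarrow> real"
  shows "\<phi> \<in> test_functions \<Omega> \<Longrightarrow> D \<sigma> \<phi> \<in> test_functions \<Omega>"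
  unfolding D_def by (rule test_functions_iter_partial)

lemma test_functions_mult:
  fixes \<phi> :: "real^'n::finite \<Rightarrow> real"
  assumes "smooth f" "\<phi> \<in> test_functions \<Omega>"
  shows "(\<lambda>x. f x * \<phi> x) \<in> test_functions \<Omega>"
  by (rule test_functionsI[OF assms(2)])
     (use assms closure_subset[of "{x. \<phi> x \<noteq> 0}"] in \<open>auto intro: smooth_mult test_functions_smooth\<close>)

lemma test_functions_support:
  fixes \<phi> :: "real^'n::finite \<Rightarrow> real"
  assumes "\<phi> \<in> test_functions \<Omega>"
  obtains K where "compact K" "K \<subseteq> \<Omega>" "\<And>x. x \<notin> K \<Longrightarrow> \<phi> x = 0"
proof
  show "compact (closure {x. \<phi> x \<noteq> 0})" "closure {x. \<phi> x \<noteq> 0} \<subseteq> \<Omega>"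
    using assms by (auto simp: test_functions_def)
  show "\<phi> x = 0" if "x \<notin> closure {x. \<phi> x \<noteq> 0}" for x
    using that closure_subset[of "{x. \<phi> x \<noteq> 0}"] by auto
qed

lemma test_functions_bounded:
  fixes \<phi> :: "real^'n::finite \<Rightarrow> real"
  assumes "\<phi> \<in> test_functions \<Omega>"
  obtains B where "B \<ge> 0" "\<And>x. \<bar>\<phi> x\<bar> \<le> B"
proof -
  obtain K where K: "compact K" "\<And>x. x \<notin> K \<Longrightarrow> \<phi> x = 0"
    using test_functions_support[OF assms] by metis
  have "compact (\<phi> ` K)"
    by (rule compact_continuous_image[OF test_functions_continuous[OF assms] K(1)])
  then obtain B where B: "\<And>y. y \<in> \<phi> ` K \<Longrightarrow> norm y \<le> B"
    using compact_imp_bounded bounded_iff by metis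
  have "\<bar>\<phi> x\<bar> \<le> max B 0" for x
    using B K(2) by (cases "x \<in> K") (auto simp: le_max_iff_disj)
  then show ?thesis using that[of "max B 0"] by simp
qed

lemma test_functions_integrable:
  fixes \<phi> :: "real^'n::finite \<Rightarrow> real"
  assumes "\<phi> \<in> test_functions \<Omega>"
  shows "integrable lborel \<phi>"
proof -
  obtain K where K: "compact K" "\<And>x. x \<notin> K \<Longrightarrow> \<phi> x = 0"
    using test_functions_support[OF assms] by metis
  have "integrable lborel (\<lambda>x. indicator K x *\<^sub>R \<phi> x)"
    by (rule borel_integrable_compact[OF K(1) test_functions_continuous[OF assms]])
  moreover have "(\<lambda>x. indicator K x *\<^sub>R \<phi> x) = \<phi>"
    using K(2) by (auto simp: fun_eq_iff indicator_def)
  ultimately show ?thesis by simp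
qed

lemma lborel_integral_shift:
  fixes F :: "real^'n::finite \<Rightarrow> real"
  assumes "F \<in> borel_measurable borel"
  shows "(LINT x|lborel. F (c + x)) = (LINT x|lborel. F x)"
proof -
  have "(LINT x|lborel. F x) = (LINT x|distr lborel borel ((+) c). F x)"
    by (simp only: lborel_distr_plus)
  also have "\<dots> = (LINT x|lborel. F (c + x))"
    by (rule integral_distr) (use assms in auto)
  finally show ?thesis by simp
qed

text \<open>By translation invariance every difference quotient has integral zero.\<close>

lemma integral_partial_deriv_eq_0:
  fixes \<phi> :: "real^'n::finite \<Rightarrow> real"
  assumes \<phi>: "\<phi> \<in> test_functions \<Omega>"
  shows "(LINT x|lborel. partial_deriv i \<phi> x) = 0"
proof -
  note \<phi>' = test_functions_partial_deriv[OF \<phi>, of i]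
  note meas = test_functions_borel[OF \<phi>] test_functions_borel[OF \<phi>']
  define t where "t m = inverse (real (Suc m))" for m
  have t: "t m > 0" "t m \<le> 1" for m by (auto simp: t_def field_simps)
  have t0: "filterlim t (at 0) sequentially"
    using LIMSEQ_inverse_real_of_nat t(1) unfolding t_def[abs_def]
    by (auto simp: filterlim_at)
  define q where "q m x = (\<phi> (t m *\<^sub>R axis i 1 + x) - \<phi> x) / t m" for m x
  have shift_meas: "(\<lambda>x. \<phi> (c + x)) \<in> borel_measurable borel" for c
    by (rule measurable_compose[OF _ meas(1)]) simp
  have shift_int: "integrable lborel (\<lambda>x. \<phi> (c + x))" for c
    using integrable_distr[of "(+) c" lborel borel \<phi>] test_functions_integrable[OF \<phi>]
    by (simp add: lborel_distr_plus)
  have zero: "(LINT x|lborel. q m x) = 0" for m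
    unfolding q_def
    using shift_int test_functions_integrable[OF \<phi>] lborel_integral_shift[OF meas(1)] by simp
  obtain K where K: "compact K" "\<And>x. x \<notin> K \<Longrightarrow> \<phi> x = 0"
    using test_functions_support[OF \<phi>] by metis
  obtain R where R: "\<And>x. x \<in> K \<Longrightarrow> norm x \<le> R"
    using compact_imp_bounded[OF K(1)] bounded_iff by metis
  obtain B where B: "B \<ge> 0" "\<And>x. \<bar>partial_deriv i \<phi> x\<bar> \<le> B"
    using test_functions_bounded[OF \<phi>'] by metis
  \<comment> \<open>Each quotient is a value of the derivative, which bounds all quotients by one
    constant.\<close>
  have q_mvt: "\<exists>y. q m x = partial_deriv i \<phi> y" for m x
  proof -
    obtain s where "\<phi> (x + t m *\<^sub>R axis i 1) - \<phi> (x + 0 *\<^sub>R axis i 1)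
        = (t m - 0) * partial_deriv i \<phi> (x + s *\<^sub>R axis i 1)"
      using MVT2[OF t(1) smooth_DERIV_line[OF test_functions_smooth[OF \<phi>]], of m x i] by blast
    then show ?thesis using t(1)[of m] by (auto simp: q_def add.commute)
  qed
  \<comment> \<open>Since \<open>t m\<close> is at most 1, all quotients vanish outside the ball
    whose radius exceeds by 1 one containing the support; this gives a common integrable
    bound.\<close>
  have "(\<lambda>m. LINT x|lborel. q m x) \<longlonglongrightarrow> (LINT x|lborel. partial_deriv i \<phi> x)"
  proof (rule integral_dominated_convergence[where w = "\<lambda>x. indicator (cball 0 (R + 1)) x * B"])
    show "partial_deriv i \<phi> \<in> borel_measurable lborel" using meas by simp
    show "q m \<in> borel_measurable lborel" for m
      unfolding q_def using shift_meas meas by simp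
    have "integrable lborel (\<lambda>x::real^'n. indicator (cball 0 (R + 1)) x *\<^sub>R B)"
      by (rule borel_integrable_compact) auto
    then show "integrable lborel (\<lambda>x::real^'n. indicator (cball 0 (R + 1)) x * B)" by simp
    show "AE x in lborel. (\<lambda>m. q m x) \<longlonglongrightarrow> partial_deriv i \<phi> x"
    proof (rule AE_I2)
      fix x
      have "((\<lambda>h. (\<phi> (x + (0 + h) *\<^sub>R axis i 1) - \<phi> (x + 0 *\<^sub>R axis i 1)) / h)
          \<longlongrightarrow> partial_deriv i \<phi> (x + 0 *\<^sub>R axis i 1)) (at 0)"
        using smooth_DERIV_line[OF test_functions_smooth[OF \<phi>], of x i 0] by (simp only: DERIV_def)
      then have "((\<lambda>h. (\<phi> (h *\<^sub>R axis i 1 + x) - \<phi> x) / h) \<longlongrightarrow> partial_deriv i \<phi> x) (at 0)"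
        by (simp add: add.commute)
      from filterlim_compose[OF this t0]
      show "(\<lambda>m. q m x) \<longlonglongrightarrow> partial_deriv i \<phi> x" by (simp add: q_def)
    qed
    show "AE x in lborel. norm (q m x) \<le> indicator (cball 0 (R + 1)) x * B" for m
    proof (rule AE_I2)
      fix x :: "real^'n"
      show "norm (q m x) \<le> indicator (cball 0 (R + 1)) x * B"
      proof (cases "norm x \<le> R + 1")
        case True
        then show ?thesis using q_mvt[of m x] B(2) by auto
      next
        case False
        have "norm x \<le> norm (t m *\<^sub>R axis i 1 + x) + norm (t m *\<^sub>R axis i (1::real) :: real^'n)"
          by (metis add_diff_cancel_left' norm_triangle_ineq4 add.commute)
        also have "norm (t m *\<^sub>R axis i (1::real) :: real^'n) \<le> 1" using t[of m] by simp
        finally have "\<not> norm (t m *\<^sub>R axis i 1 + x) \<le> R" using False by simp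
        moreover have "\<not> norm x \<le> R" using False by simp
        ultimately have "\<phi> (t m *\<^sub>R axis i 1 + x) = 0" "\<phi> x = 0" using R K(2) by blast+
        then show ?thesis using B(1) by (simp add: q_def)
      qed
    qed
  qed
  then show ?thesis by (simp add: zero LIMSEQ_const_iff)
qed

text \<open>The product with a test function is again a test function, so the integral of its
  derivative is 0; the product rule splits it.\<close>

lemma integral_by_parts:
  fixes \<phi> :: "real^'n::finite \<Rightarrow> real"
  assumes f: "smooth f" and \<phi>: "\<phi> \<in> test_functions \<Omega>"
  shows "(LINT x|lborel. partial_deriv i f x * \<phi> x) = - (LINT x|lborel. f x * partial_deriv i \<phi> x)"
proof -
  have "partial_deriv i (\<lambda>x. f x * \<phi> x) = (\<lambda>x. f x * partial_deriv i \<phi> x + partial_deriv i f x * \<phi> x)"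
    by (intro ext partial_deriv_mult smooth_differentiable f test_functions_smooth[OF \<phi>])
  moreover have "integrable lborel (\<lambda>x. f x * partial_deriv i \<phi> x)"
    "integrable lborel (\<lambda>x. partial_deriv i f x * \<phi> x)"
    by (intro test_functions_integrable[of _ \<Omega>] test_functions_mult test_functions_partial_deriv
        smooth_partial_deriv f \<phi>)+
  ultimately show ?thesis
    using integral_partial_deriv_eq_0[OF test_functions_mult[OF f \<phi>], of i] by simp
qed

text \<open>The outermost derivative of \<open>f\<close> moves first and so becomes innermost on
  \<phi>; this reverses the list.\<close>

lemma integral_iter_partial_by_parts:
  fixes \<phi> :: "real^'n::finite \<Rightarrow> real"
  assumes f: "smooth f" and \<phi>: "\<phi> \<in> test_functions \<Omega>"
  shows "(LINT x|lborel. iter_partial is f x * \<phi> x)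
    = (-1) ^ length is * (LINT x|lborel. f x * iter_partial (rev is) \<phi> x)"
  using \<phi>
proof (induction "is" arbitrary: \<phi>)
  case (Cons i "is")
  have "(LINT x|lborel. iter_partial (i # is) f x * \<phi> x)
      = - (LINT x|lborel. iter_partial is f x * partial_deriv i \<phi> x)"
    using integral_by_parts[OF smooth_iter_partial[OF f] Cons.prems] by simp
  also have "\<dots> = - ((-1) ^ length is * (LINT x|lborel. f x * iter_partial (rev is) (partial_deriv i \<phi>) x))"
    by (simp only: Cons.IH[OF test_functions_partial_deriv[OF Cons.prems]])
  finally show ?case by (simp add: iter_partial_append)
qed simp

lemma integral_D_by_parts:
  fixes \<phi> :: "real^'n::finite \<Rightarrow> real"
  assumes f: "smooth f" and \<phi>: "\<phi> \<in> test_functions \<Omega>"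
  shows "(LINT x|lborel. D \<sigma> f x * \<phi> x) = (-1) ^ mi_order \<sigma> * (LINT x|lborel. f x * D \<sigma> \<phi> x)"
proof -
  obtain "is" where "length is = mi_order \<sigma>" "D \<sigma> f = iter_partial is f" "D \<sigma> \<phi> = iter_partial is \<phi>"
    using f test_functions_smooth[OF \<phi>] by (metis obtain_D_list)
  moreover have "iter_partial (rev is) \<phi> = iter_partial is \<phi>"
    by (rule iter_partial_perm[OF test_functions_smooth[OF \<phi>]]) simp
  ultimately show ?thesis using integral_iter_partial_by_parts[OF f \<phi>, of "is"] by simp
qed

section \<open>Weak derivatives\<close>

lemma open_Int_space_lebesgue: "open \<Omega> \<Longrightarrow> \<Omega> \<inter> space lebesgue \<in> sets lebesgue"
  by auto

text \<open>Rests on the completeness of Lebesgue measure.\<close>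

lemma borel_measurable_lebesgue_on_AE:
  fixes f g :: "real^'n::finite \<Rightarrow> real"
  assumes "open \<Omega>" "f \<in> borel_measurable (lebesgue_on \<Omega>)" "AE x in lebesgue_on \<Omega>. f x = g x"
  shows "g \<in> borel_measurable (lebesgue_on \<Omega>)"
proof -
  note \<Omega> = open_Int_space_lebesgue[OF assms(1)]
  have "AE x in lebesgue. x \<in> \<Omega> \<longrightarrow> f x = g x"
    using assms(3) by (simp add: AE_restrict_space_iff[OF \<Omega>])
  then have "AE x in lebesgue. f x * indicator \<Omega> x = g x * indicator \<Omega> x"
    by eventually_elim (auto simp: indicator_def)
  moreover have "(\<lambda>x. f x * indicator \<Omega> x) \<in> borel_measurable lebesgue"
    using assms(2) by (simp add: borel_measurable_restrict_space_iff[OF \<Omega>] mult.commute)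
  ultimately have "(\<lambda>x. g x * indicator \<Omega> x) \<in> borel_measurable lebesgue"
    by (rule borel_measurable_AE[rotated])
  then show ?thesis by (simp add: borel_measurable_restrict_space_iff[OF \<Omega>] mult.commute)
qed

text \<open>No measurability has to be assumed: it holds for both functions or for neither, and in
  the latter case both integrals have the default value 0.\<close>

lemma integral_lebesgue_on_cong_AE:
  fixes f g :: "real^'n::finite \<Rightarrow> real"
  assumes "open \<Omega>" "AE x in lebesgue_on \<Omega>. f x = g x"
  shows "integral\<^sup>L (lebesgue_on \<Omega>) f = integral\<^sup>L (lebesgue_on \<Omega>) g"
proof -
  have "AE x in lebesgue_on \<Omega>. g x = f x" using assms(2) by eventually_elim simp
  then have "f \<in> borel_measurable (lebesgue_on \<Omega>) \<longleftrightarrow> g \<in> borel_measurable (lebesgue_on \<Omega>)"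
    using borel_measurable_lebesgue_on_AE assms by blast
  then show ?thesis
    using integral_cong_AE[OF _ _ assms(2)] not_integrable_integral_eq
    by (metis borel_measurable_integrable)
qed

lemma locally_integrable_continuous:
  fixes f :: "real^'n::finite \<Rightarrow> real"
  assumes "continuous_on UNIV f" shows "locally_integrable \<Omega> f"
  unfolding locally_integrable_def
proof (intro allI impI)
  fix K assume K: "compact K \<and> K \<subseteq> \<Omega>"
  then have "integrable lborel (\<lambda>x. indicator K x *\<^sub>R f x)"
    by (intro borel_integrable_compact continuous_on_subset[OF assms]) auto
  then have "integrable lebesgue (\<lambda>x. indicator K x *\<^sub>R f x)"
    by (subst integrable_completion) (auto dest: borel_measurable_integrable)
  then show "f absolutely_integrable_on K" by (simp add: set_integrable_def)
qed

lemma lebesgue_on_eq_lborel: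
  fixes \<phi> f :: "real^'n::finite \<Rightarrow> real"
  assumes "open \<Omega>" "\<phi> \<in> test_functions \<Omega>" "f \<in> borel_measurable borel"
  shows "(LINT x|lebesgue_on \<Omega>. f x * \<phi> x) = (LINT x|lborel. f x * \<phi> x)"
  unfolding lebesgue_on_test_function(1)[OF assms(1,2)]
  by (rule integral_completion) (use assms(3) test_functions_borel[OF assms(2)] in simp)

lemma integrable_locally_integrable_mult:
  fixes \<phi> v :: "real^'n::finite \<Rightarrow> real"
  assumes "open \<Omega>" "locally_integrable \<Omega> v" "\<phi> \<in> test_functions \<Omega>"
  shows "integrable (lebesgue_on \<Omega>) (\<lambda>x. v x * \<phi> x)"
proof -
  obtain K where K: "compact K" "K \<subseteq> \<Omega>" "\<And>x. x \<notin> K \<Longrightarrow> \<phi> x = 0"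
    using test_functions_support[OF assms(3)] by metis
  obtain B where B: "B \<ge> 0" "\<And>x. \<bar>\<phi> x\<bar> \<le> B"
    using test_functions_bounded[OF assms(3)] by metis
  define w where "w x = indicator K x * v x" for x
  have w: "integrable lebesgue w"
    using assms(2) K(1,2) by (auto simp: locally_integrable_def set_integrable_def w_def[abs_def])
  have "integrable lebesgue (\<lambda>x. w x * \<phi> x)"
  proof (rule Bochner_Integration.integrable_bound)
    show "integrable lebesgue (\<lambda>x. B * w x)" using w by simp
    show "(\<lambda>x. w x * \<phi> x) \<in> borel_measurable lebesgue"
      using w test_functions_borel[OF assms(3)]
      by (intro borel_measurable_times) (auto intro: measurable_completion)
    show "AE x in lebesgue. norm (w x * \<phi> x) \<le> norm (B * w x)"
      using B by (intro AE_I2) (simp add: abs_mult mult.commute[of B] mult_left_mono)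
  qed
  moreover have "(\<lambda>x. w x * \<phi> x) = (\<lambda>x. v x * \<phi> x)"
    using K(3) by (auto simp: fun_eq_iff w_def indicator_def)
  ultimately show ?thesis by (simp add: lebesgue_on_test_function(2)[OF assms(1,3)])
qed

text \<open>The uniqueness principle that resolves the choices in both \<open>weak_deriv\<close> and
  \<open>calL\<close>.\<close>

lemma AE_eq_if_weakly_eq:
  fixes v w :: "real^'n::finite \<Rightarrow> real"
  assumes \<Omega>: "open \<Omega>" and v: "locally_integrable \<Omega> v" and w: "locally_integrable \<Omega> w"
    and eq: "\<And>\<phi>. \<phi> \<in> test_functions \<Omega> \<Longrightarrow>
      (LINT x|lebesgue_on \<Omega>. v x * \<phi> x) = (LINT x|lebesgue_on \<Omega>. w x * \<phi> x)"
  shows "AE x in lebesgue_on \<Omega>. v x = w x"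
proof -
  have "AE x in lebesgue_on \<Omega>. v x - w x = 0"
  proof (rule fundamental_lemma[OF \<Omega>])
    show "locally_integrable \<Omega> (\<lambda>x. v x - w x)"
      using v w by (auto simp: locally_integrable_def)
    show "(LINT x|lebesgue_on \<Omega>. (v x - w x) * \<phi> x) = 0" if "\<phi> \<in> test_functions \<Omega>" for \<phi>
      using eq[OF that] integrable_locally_integrable_mult[OF \<Omega> v that]
        integrable_locally_integrable_mult[OF \<Omega> w that] by (simp add: left_diff_distrib)
  qed
  then show ?thesis by eventually_elim simp
qed

lemma has_weak_deriv_AE_unique:
  fixes u :: "real^'n::finite \<Rightarrow> real"
  assumes "open \<Omega>" "has_weak_deriv \<Omega> \<sigma> u v" "has_weak_deriv \<Omega> \<sigma> u w"
  shows "AE x in lebesgue_on \<Omega>. v x = w x"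
proof (rule AE_eq_if_weakly_eq[OF assms(1)])
  show "locally_integrable \<Omega> v" "locally_integrable \<Omega> w"
    using assms(2,3) by (auto simp: has_weak_deriv_def)
  show "(LINT x|lebesgue_on \<Omega>. v x * \<phi> x) = (LINT x|lebesgue_on \<Omega>. w x * \<phi> x)"
    if "\<phi> \<in> test_functions \<Omega>" for \<phi>
  proof -
    have "(-1::real) ^ mi_order \<sigma> * (LINT x|lebesgue_on \<Omega>. v x * \<phi> x)
        = (-1) ^ mi_order \<sigma> * (LINT x|lebesgue_on \<Omega>. w x * \<phi> x)"
      using bspec[OF assms(2)[unfolded has_weak_deriv_def, THEN conjunct2, THEN conjunct2] that]
        bspec[OF assms(3)[unfolded has_weak_deriv_def, THEN conjunct2, THEN conjunct2] that] by simp
    then show ?thesis by simp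
  qed
qed

lemma has_weak_deriv_weak_deriv:
  "has_weak_deriv \<Omega> \<sigma> u v \<Longrightarrow> has_weak_deriv \<Omega> \<sigma> u (weak_deriv \<Omega> \<sigma> u)"
  unfolding weak_deriv_def by (rule someI[of "has_weak_deriv \<Omega> \<sigma> u"])

lemma weak_deriv_AE:
  fixes u :: "real^'n::finite \<Rightarrow> real"
  assumes "open \<Omega>" "has_weak_deriv \<Omega> \<sigma> u v"
  shows "AE x in lebesgue_on \<Omega>. weak_deriv \<Omega> \<sigma> u x = v x"
  using has_weak_deriv_AE_unique has_weak_deriv_weak_deriv assms by blast

lemma has_weak_deriv_D:
  fixes \<psi> :: "real^'n::finite \<Rightarrow> real"
  assumes "open \<Omega>" "smooth \<psi>"
  shows "has_weak_deriv \<Omega> \<sigma> \<psi> (D \<sigma> \<psi>)"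
  unfolding has_weak_deriv_def
proof (intro conjI ballI)
  show "locally_integrable \<Omega> \<psi>" "locally_integrable \<Omega> (D \<sigma> \<psi>)"
    using assms(2) by (auto intro!: locally_integrable_continuous smooth_continuous_on smooth_D)
  fix \<phi> assume \<phi>: "\<phi> \<in> test_functions \<Omega>"
  have "\<psi> \<in> borel_measurable borel" "D \<sigma> \<psi> \<in> borel_measurable borel"
    using assms(2) by (auto intro!: borel_measurable_continuous_onI smooth_continuous_on smooth_D)
  then show "(LINT x|lebesgue_on \<Omega>. \<psi> x * D \<sigma> \<phi> x) = (-1) ^ mi_order \<sigma> * (LINT x|lebesgue_on \<Omega>. D \<sigma> \<psi> x * \<phi> x)"
    using assms \<phi> by (simp add: lebesgue_on_eq_lborel test_functions_D integral_D_by_parts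
        flip: mult.assoc power_mult_distrib)
qed

section \<open>Test functions as members of the Sobolev spaces\<close>

lemma test_functions_L2:
  fixes \<phi> :: "real^'n::finite \<Rightarrow> real"
  assumes "open \<Omega>" "\<phi> \<in> test_functions \<Omega>"
  shows "\<phi> \<in> L2 \<Omega>"
proof -
  have "\<phi> \<in> borel_measurable (lebesgue_on \<Omega>)"
    using test_functions_borel[OF assms(2)] by (intro measurable_restrict_space1 measurable_completion) simp
  moreover have "locally_integrable \<Omega> \<phi>"
    using test_functions_continuous[OF assms(2)] by (rule locally_integrable_continuous)
  then have "integrable (lebesgue_on \<Omega>) (\<lambda>x. \<phi> x * \<phi> x)"
    by (rule integrable_locally_integrable_mult[OF assms(1) _ assms(2)])
  ultimately show ?thesis by (simp add: L2_def power2_eq_square)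
qed

text \<open>The chosen weak derivative of 0 is only known to vanish almost everywhere. Used for the
  constant sequence that approximates a test function by itself in \<open>H0k\<close>.\<close>

lemma Hk_norm_zero:
  assumes "open \<Omega>"
  shows "Hk_norm k \<Omega> (\<lambda>x::real^'n::finite. 0) = 0"
proof -
  have "(LINT x|lebesgue_on \<Omega>. (weak_deriv \<Omega> \<sigma> (\<lambda>x::real^'n. 0) x)\<^sup>2) = 0" for \<sigma>
  proof -
    have "D \<sigma> (\<lambda>x::real^'n. 0) = (\<lambda>x. 0)" by (simp add: D_def iter_partial_zero)
    then have "AE x in lebesgue_on \<Omega>. weak_deriv \<Omega> \<sigma> (\<lambda>x::real^'n. 0) x = 0"
      using weak_deriv_AE[OF assms has_weak_deriv_D[OF assms smooth_const[of 0], of \<sigma>]] by simp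
    then have "AE x in lebesgue_on \<Omega>. (weak_deriv \<Omega> \<sigma> (\<lambda>x::real^'n. 0) x)\<^sup>2 = 0"
      by eventually_elim simp
    then show ?thesis by (rule integral_eq_zero_AE)
  qed
  then show ?thesis by (simp add: Hk_norm_def Hk_seminorm_def)
qed

lemma test_functions_H0k:
  fixes \<phi> :: "real^'n::finite \<Rightarrow> real"
  assumes "open \<Omega>" "\<phi> \<in> test_functions \<Omega>"
  shows "\<phi> \<in> H0k k \<Omega>"
  unfolding H0k_def Hk_def mem_Collect_eq
proof (intro conjI allI impI exI)
  show "\<phi> \<in> L2 \<Omega>" using assms by (rule test_functions_L2)
  show "\<exists>v\<in>L2 \<Omega>. has_weak_deriv \<Omega> \<sigma> \<phi> v" for \<sigma>
    using assms by (intro bexI[of _ "D \<sigma> \<phi>"])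
      (auto intro: has_weak_deriv_D test_functions_smooth test_functions_L2 test_functions_D)
  show "(\<lambda>_. \<phi>) m \<in> test_functions \<Omega>" for m :: nat using assms by simp
  show "(\<lambda>m. Hk_norm k \<Omega> (\<lambda>x. \<phi> x - (\<lambda>_. \<phi>) m x)) \<longlonglongrightarrow> 0"
    by (simp add: Hk_norm_zero[OF assms(1)])
qed

section \<open>Weak solutions\<close>

lemma L2_AE:
  fixes f g :: "real^'n::finite \<Rightarrow> real"
  assumes "open \<Omega>" "f \<in> L2 \<Omega>" "AE x in lebesgue_on \<Omega>. f x = g x"
  shows "g \<in> L2 \<Omega>"
proof -
  have meas: "g \<in> borel_measurable (lebesgue_on \<Omega>)"
    using assms by (intro borel_measurable_lebesgue_on_AE[OF assms(1) _ assms(3)]) (simp add: L2_def)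
  have "integrable (lebesgue_on \<Omega>) (\<lambda>x. (g x)\<^sup>2)"
  proof (rule integrable_cong_AE_imp)
    show "integrable (lebesgue_on \<Omega>) (\<lambda>x. (f x)\<^sup>2)" using assms(2) by (simp add: L2_def)
    show "(\<lambda>x. (g x)\<^sup>2) \<in> borel_measurable (lebesgue_on \<Omega>)" using meas by (rule borel_measurable_power)
    show "AE x in lebesgue_on \<Omega>. (f x)\<^sup>2 = (g x)\<^sup>2" using assms(3) by eventually_elim simp
  qed
  with meas show ?thesis by (simp add: L2_def)
qed

lemma L2_integrable_mult:
  assumes "f \<in> L2 \<Omega>" "g \<in> L2 \<Omega>"
  shows "integrable (lebesgue_on \<Omega>) (\<lambda>x. f x * g x)"
proof (rule Bochner_Integration.integrable_bound)
  show "integrable (lebesgue_on \<Omega>) (\<lambda>x. (f x)\<^sup>2 + (g x)\<^sup>2)"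
    using assms by (auto simp: L2_def)
  show "(\<lambda>x. f x * g x) \<in> borel_measurable (lebesgue_on \<Omega>)"
    using assms by (auto simp: L2_def)
  have "\<bar>a * b\<bar> \<le> a\<^sup>2 + b\<^sup>2" for a b :: real
  proof -
    have "0 \<le> (\<bar>a\<bar> - \<bar>b\<bar>)\<^sup>2" "0 \<le> \<bar>a\<bar> * \<bar>b\<bar>" by simp_all
    moreover have "2 * \<bar>a\<bar> * \<bar>b\<bar> = \<bar>a\<bar> * \<bar>b\<bar> + \<bar>a\<bar> * \<bar>b\<bar>" by simp
    ultimately show ?thesis by (simp only: power2_diff abs_mult power2_abs)
  qed
  then show "AE x in lebesgue_on \<Omega>. norm (f x * g x) \<le> norm ((f x)\<^sup>2 + (g x)\<^sup>2)" by simp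
qed

lemma L2_locally_integrable:
  fixes f :: "real^'n::finite \<Rightarrow> real"
  assumes "open \<Omega>" "f \<in> L2 \<Omega>" shows "locally_integrable \<Omega> f"
  unfolding locally_integrable_def
proof (intro allI impI)
  fix K assume K: "compact K \<and> K \<subseteq> \<Omega>"
  note \<Omega> = open_Int_space_lebesgue[OF assms(1)]
  have f: "(\<lambda>x. indicator \<Omega> x * f x) \<in> borel_measurable lebesgue"
    "integrable lebesgue (\<lambda>x. indicator \<Omega> x * (f x)\<^sup>2)"
    using assms(2) by (simp_all add: L2_def borel_measurable_restrict_space_iff[OF \<Omega>]
        integrable_restrict_space[OF \<Omega>])
  have Km: "K \<in> lmeasurable" using K by (simp add: lmeasurable_compact)
  have eq: "(\<lambda>x. indicator K x * f x) = (\<lambda>x. indicator K x * (indicator \<Omega> x * f x))"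
    using K by (auto simp: indicator_def fun_eq_iff)
  have "integrable lebesgue (\<lambda>x. indicator K x * f x)"
  proof (rule Bochner_Integration.integrable_bound)
    show "integrable lebesgue (\<lambda>x. indicator K x + indicator \<Omega> x * (f x)\<^sup>2)"
      using f(2) Km by (intro Bochner_Integration.integrable_add) (auto simp: fmeasurable_def)
    show "(\<lambda>x. indicator K x * f x) \<in> borel_measurable lebesgue"
      unfolding eq using Km by (intro borel_measurable_times[OF borel_measurable_indicator f(1)]) (simp add: fmeasurableD)
    \<comment> \<open>On a compact set the constant 1 is integrable, so square integrability
      suffices.\<close>
    have "\<bar>f x\<bar> \<le> 1 + (f x)\<^sup>2" for x
      using sum_squares_ge_zero[of "\<bar>f x\<bar> - 1" 0] zero_le_power2[of "f x"] zero_le_power2[of "\<bar>f x\<bar> - 1"]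
      by (simp add: power2_diff)
    then show "AE x in lebesgue. norm (indicator K x * f x) \<le> norm (indicator K x + indicator \<Omega> x * (f x)\<^sup>2)"
      using K by (intro AE_I2) (auto simp: indicator_def)
  qed
  then show "f absolutely_integrable_on K" by (simp add: set_integrable_def)
qed

lemma Hk_weak_deriv:
  fixes u :: "real^'n::finite \<Rightarrow> real"
  assumes "open \<Omega>" "u \<in> Hk k \<Omega>" "mi_order \<sigma> \<le> k"
  shows "has_weak_deriv \<Omega> \<sigma> u (weak_deriv \<Omega> \<sigma> u)" "weak_deriv \<Omega> \<sigma> u \<in> L2 \<Omega>"
proof -
  obtain v where v: "v \<in> L2 \<Omega>" "has_weak_deriv \<Omega> \<sigma> u v"
    using assms by (auto simp: Hk_def)
  show "has_weak_deriv \<Omega> \<sigma> u (weak_deriv \<Omega> \<sigma> u)"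
    using v(2) by (rule has_weak_deriv_weak_deriv)
  from has_weak_deriv_AE_unique[OF assms(1) v(2) this]
  show "weak_deriv \<Omega> \<sigma> u \<in> L2 \<Omega>" by (rule L2_AE[OF assms(1) v(1)])
qed

lemma weak_solution_test:
  fixes u f :: "real^'n::finite \<Rightarrow> real"
  assumes \<Omega>: "open \<Omega>" and u: "weak_solution k \<Omega> f u" and \<phi>: "\<phi> \<in> test_functions \<Omega>"
  shows "(LINT x|lebesgue_on \<Omega>. f x * \<phi> x)
    = (\<Sum>\<sigma> | mi_order \<sigma> = k. LINT x|lebesgue_on \<Omega>. weak_deriv \<Omega> \<sigma> u x * D \<sigma> \<phi> x)"
proof -
  have "(LINT x|lebesgue_on \<Omega>. f x * \<phi> x)
      = (\<Sum>\<sigma> | mi_order \<sigma> = k. LINT x|lebesgue_on \<Omega>. weak_deriv \<Omega> \<sigma> u x * weak_deriv \<Omega> \<sigma> \<phi> x)"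
    using u test_functions_H0k[OF \<Omega> \<phi>, of k] by (auto simp: weak_solution_def)
  also have "\<dots> = (\<Sum>\<sigma> | mi_order \<sigma> = k. LINT x|lebesgue_on \<Omega>. weak_deriv \<Omega> \<sigma> u x * D \<sigma> \<phi> x)"
  proof (intro sum.cong refl integral_lebesgue_on_cong_AE[OF \<Omega>])
    fix \<sigma>
    show "AE x in lebesgue_on \<Omega>. weak_deriv \<Omega> \<sigma> u x * weak_deriv \<Omega> \<sigma> \<phi> x = weak_deriv \<Omega> \<sigma> u x * D \<sigma> \<phi> x"
      using weak_deriv_AE[OF \<Omega> has_weak_deriv_D[OF \<Omega> test_functions_smooth[OF \<phi>]], of \<sigma>]
      by eventually_elim simp
  qed
  finally show ?thesis .
qed

text \<open>\<open>D \<sigma> \<phi>\<close> is itself a test function, so the definition of the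
  weak derivative can be applied to it; this moves the remaining derivatives off \<open>u\<close>
  and yields the sign (-1)^k.\<close>

lemma weak_solution_is_calL:
  fixes u f :: "real^'n::finite \<Rightarrow> real"
  assumes \<Omega>: "open \<Omega>" and u: "weak_solution k \<Omega> f u"
  shows "is_calL k \<Omega> u f"
  unfolding is_calL_def
proof
  fix \<phi> assume \<phi>: "\<phi> \<in> test_functions \<Omega>"
  have uk: "u \<in> Hk k \<Omega>" using u by (auto simp: weak_solution_def H0k_def)
  have "(LINT x|lebesgue_on \<Omega>. weak_deriv \<Omega> \<sigma> u x * D \<sigma> \<phi> x)
      = (-1) ^ k * (LINT x|lebesgue_on \<Omega>. u x * D (\<lambda>i. 2 * \<sigma> i) \<phi> x)" if "mi_order \<sigma> = k" for \<sigma>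
  proof -
    have "has_weak_deriv \<Omega> \<sigma> u (weak_deriv \<Omega> \<sigma> u)" using Hk_weak_deriv(1)[OF \<Omega> uk] that by simp
    then have "(LINT x|lebesgue_on \<Omega>. u x * D \<sigma> (D \<sigma> \<phi>) x)
        = (-1) ^ k * (LINT x|lebesgue_on \<Omega>. weak_deriv \<Omega> \<sigma> u x * D \<sigma> \<phi> x)"
      using test_functions_D[OF \<phi>, of \<sigma>] that by (auto simp: has_weak_deriv_def)
    then show ?thesis
      by (simp add: D_D[OF test_functions_smooth[OF \<phi>]] flip: mult.assoc power_mult_distrib)
  qed
  then show "(LINT x|lebesgue_on \<Omega>. f x * \<phi> x)
      = (-1) ^ k * (\<Sum>\<sigma> | mi_order \<sigma> = k. LINT x|lebesgue_on \<Omega>. u x * D (\<lambda>i. 2 * \<sigma> i) \<phi> x)"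
    by (simp add: weak_solution_test[OF \<Omega> u \<phi>] sum_distrib_left)
qed

text \<open>\<open>f\<close> is a witness for the choice in \<open>calL\<close>, and any two
  witnesses agree almost everywhere.\<close>

lemma L2_norm_on_calL:
  fixes u f :: "real^'n::finite \<Rightarrow> real"
  assumes \<Omega>: "open \<Omega>" and u: "weak_solution k \<Omega> f u" and f: "f \<in> L2 \<Omega>"
  shows "L2_norm_on \<Omega> (calL k \<Omega> u) = L2_norm_on \<Omega> f"
proof -
  have f': "f \<in> L2 \<Omega> \<and> is_calL k \<Omega> u f" using f weak_solution_is_calL[OF \<Omega> u] by blast
  then have g: "calL k \<Omega> u \<in> L2 \<Omega> \<and> is_calL k \<Omega> u (calL k \<Omega> u)"
    unfolding calL_def by (rule someI[of "\<lambda>f. f \<in> L2 \<Omega> \<and> is_calL k \<Omega> u f"])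
  have "AE x in lebesgue_on \<Omega>. calL k \<Omega> u x = f x"
  proof (rule AE_eq_if_weakly_eq[OF \<Omega>])
    show "locally_integrable \<Omega> (calL k \<Omega> u)" "locally_integrable \<Omega> f"
      using f g L2_locally_integrable[OF \<Omega>] by blast+
    show "(LINT x|lebesgue_on \<Omega>. calL k \<Omega> u x * \<phi> x) = (LINT x|lebesgue_on \<Omega>. f x * \<phi> x)"
      if "\<phi> \<in> test_functions \<Omega>" for \<phi>
      using f' g that by (auto simp: is_calL_def)
  qed
  then have "AE x in lebesgue_on \<Omega>. (calL k \<Omega> u x)\<^sup>2 = (f x)\<^sup>2" by eventually_elim simp
  then show ?thesis
    unfolding L2_norm_on_def by (simp only: integral_lebesgue_on_cong_AE[OF \<Omega>])
qed

text \<open>Stated for families so that the sum over \<sigma> and the integral are treated as one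
  inner product. The square of a - t b has nonnegative integral for all t, and a suitable t is
  inserted.\<close>

lemma Cauchy_Schwarz_L2:
  assumes a: "\<And>s. s \<in> A \<Longrightarrow> a s \<in> L2 \<Omega>" and b: "\<And>s. s \<in> A \<Longrightarrow> b s \<in> L2 \<Omega>"
  shows "(\<Sum>s\<in>A. LINT x|lebesgue_on \<Omega>. a s x * b s x)
    \<le> sqrt (\<Sum>s\<in>A. LINT x|lebesgue_on \<Omega>. (a s x)\<^sup>2) * sqrt (\<Sum>s\<in>A. LINT x|lebesgue_on \<Omega>. (b s x)\<^sup>2)"
    (is "?X \<le> sqrt ?P * sqrt ?Q")
proof -
  have quadratic: "0 \<le> ?P - 2 * t * ?X + t\<^sup>2 * ?Q" for t
  proof -
    have "0 \<le> (\<Sum>s\<in>A. LINT x|lebesgue_on \<Omega>. (a s x - t * b s x)\<^sup>2)"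
      by (intro sum_nonneg Bochner_Integration.integral_nonneg) simp
    also have "\<dots> = (\<Sum>s\<in>A. (LINT x|lebesgue_on \<Omega>. (a s x)\<^sup>2)
        - 2 * t * (LINT x|lebesgue_on \<Omega>. a s x * b s x) + t\<^sup>2 * (LINT x|lebesgue_on \<Omega>. (b s x)\<^sup>2))"
    proof (rule sum.cong[OF refl])
      fix s assume s: "s \<in> A"
      have "(a s x - t * b s x)\<^sup>2 = (a s x)\<^sup>2 - 2 * t * (a s x * b s x) + t\<^sup>2 * (b s x)\<^sup>2" for x
        by (simp add: power2_eq_square algebra_simps)
      then show "(LINT x|lebesgue_on \<Omega>. (a s x - t * b s x)\<^sup>2) = (LINT x|lebesgue_on \<Omega>. (a s x)\<^sup>2)
        - 2 * t * (LINT x|lebesgue_on \<Omega>. a s x * b s x) + t\<^sup>2 * (LINT x|lebesgue_on \<Omega>. (b s x)\<^sup>2)"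
        using a[OF s] b[OF s] L2_integrable_mult[OF a[OF s] b[OF s]] by (simp add: L2_def)
    qed
    also have "\<dots> = ?P - 2 * t * ?X + t\<^sup>2 * ?Q"
      by (simp add: sum.distrib sum_subtractf sum_distrib_left)
    finally show ?thesis .
  qed
  have nonneg: "?P \<ge> 0" "?Q \<ge> 0"
    by (intro sum_nonneg Bochner_Integration.integral_nonneg; simp)+
  have "?X\<^sup>2 \<le> ?P * ?Q"
  proof (cases "?Q = 0")
    case True
    have "?X = 0"
    proof (rule ccontr)
      assume "?X \<noteq> 0"
      \<comment> \<open>If Q = 0 the form is linear in t; this t would give it the value -1.\<close>
      then have "2 * ((?P + 1) / (2 * ?X)) * ?X = ?P + 1" by simp
      then show False using quadratic[of "(?P + 1) / (2 * ?X)"] True by simp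
    qed
    then show ?thesis using True by simp
  next
    case False
    with nonneg have "?Q > 0" by simp
    \<comment> \<open>X/Q is the minimiser of the quadratic.\<close>
    then show ?thesis
      using quadratic[of "?X / ?Q"] by (simp add: power2_eq_square field_simps)
  qed
  then show ?thesis by (simp add: real_le_rsqrt flip: real_sqrt_mult)
qed

lemma weak_solution_test_le:
  fixes u f :: "real^'n::finite \<Rightarrow> real"
  assumes \<Omega>: "open \<Omega>" and u: "weak_solution k \<Omega> f u" and v: "v \<in> test_functions \<Omega>"
  shows "(LINT x|lebesgue_on \<Omega>. f x * v x)
    \<le> Hk_seminorm k \<Omega> u * sqrt (\<Sum>\<sigma> | mi_order \<sigma> = k. LINT x|lebesgue_on \<Omega>. (D \<sigma> v x)\<^sup>2)"
  unfolding weak_solution_test[OF assms] Hk_seminorm_def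
proof (rule Cauchy_Schwarz_L2)
  have "u \<in> Hk k \<Omega>" using u by (auto simp: weak_solution_def H0k_def)
  then show "weak_deriv \<Omega> \<sigma> u \<in> L2 \<Omega>" if "\<sigma> \<in> {\<sigma>. mi_order \<sigma> = k}" for \<sigma>
    using Hk_weak_deriv(2)[OF \<Omega>] that by auto
  show "D \<sigma> v \<in> L2 \<Omega>" for \<sigma>
    using \<Omega> v by (intro test_functions_L2 test_functions_D)
qed

section \<open>Polynomials on a cube\<close>

definition monomial :: "'n multi_index \<Rightarrow> real^'n::finite \<Rightarrow> real" where
  "monomial \<tau> x = (\<Prod>i\<in>UNIV. x $ i ^ \<tau> i)"

lemma smooth_monomial: "smooth (monomial \<tau>)"
  unfolding monomial_def[abs_def] by (intro smooth_prod smooth_power smooth_coordinate)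

lemma monomial_scale: "monomial \<tau> (c *\<^sub>R x) = c ^ mi_order \<tau> * monomial \<tau> x"
  by (simp add: monomial_def mi_order_def power_mult_distrib prod.distrib power_sum)

lemma abs_monomial_le_1: "(\<And>i. \<bar>x $ i\<bar> \<le> 1) \<Longrightarrow> \<bar>monomial \<tau> x\<bar> \<le> 1"
  unfolding monomial_def abs_prod by (intro prod_le_1) (auto simp: power_abs power_le_one)

text \<open>Uniqueness of base N expansions, reading off the lowest digit modulo N. It makes the
  substitution below injective on exponents.\<close>

lemma digits_unique:
  fixes f g :: "nat \<Rightarrow> nat"
  assumes "\<And>j. j < n \<Longrightarrow> f j < N" "\<And>j. j < n \<Longrightarrow> g j < N"
    and "(\<Sum>j<n. f j * N ^ j) = (\<Sum>j<n. g j * N ^ j)" and "j < n"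
  shows "f j = g j"
  using assms
proof (induction n arbitrary: f g j)
  case (Suc n)
  have shift: "(\<Sum>j<Suc n. h j * N ^ j) = h 0 + N * (\<Sum>j<n. h (Suc j) * N ^ j)" for h :: "nat \<Rightarrow> nat"
    by (simp add: sum.lessThan_Suc_shift sum_distrib_left mult_ac del: sum.lessThan_Suc)
  have *: "f 0 + N * (\<Sum>j<n. f (Suc j) * N ^ j) = g 0 + N * (\<Sum>j<n. g (Suc j) * N ^ j)"
    using Suc.prems(3) unfolding shift .
  have N: "f 0 < N" "g 0 < N" using Suc.prems(1,2) by auto
  have "f 0 = g 0" using arg_cong[OF *, of "\<lambda>m. m mod N"] N by simp
  moreover have "(\<Sum>j<n. f (Suc j) * N ^ j) = (\<Sum>j<n. g (Suc j) * N ^ j)"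
    using * N \<open>f 0 = g 0\<close> by simp
  then have "f (Suc j) = g (Suc j)" if "j < n" for j
    using Suc.IH[of "\<lambda>j. f (Suc j)" "\<lambda>j. g (Suc j)" j] Suc.prems(1,2) that by simp
  ultimately show ?case using Suc.prems(4) by (cases j) auto
qed simp

text \<open>Kronecker substitution: with \<^term>\<open>N\<close> above all exponents, setting the coordinates to
  \<^term>\<open>t ^ (N ^ e i)\<close> for an enumeration \<^term>\<open>e\<close> sends distinct monomials to distinct powers
  of \<^term>\<open>t\<close>.\<close>

lemma monomials_independent:
  fixes b :: "'n::finite multi_index \<Rightarrow> real"
  assumes T: "finite T" and r: "r > 0"
    and zero: "\<And>x. (\<And>i. \<bar>x $ i\<bar> < r) \<Longrightarrow> (\<Sum>\<tau>\<in>T. b \<tau> * monomial \<tau> x) = 0"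
    and \<tau>: "\<tau> \<in> T"
  shows "b \<tau> = 0"
proof -
  obtain e :: "'n \<Rightarrow> nat" where e: "bij_betw e UNIV {..<CARD('n)}"
    using ex_bij_betw_finite_nat[of "UNIV :: 'n set"] by (auto simp: atLeast0LessThan)
  \<comment> \<open>The sum of all orders bounds each single exponent, so exponents are base N
    digits.\<close>
  define N where "N = Suc (\<Sum>\<tau>\<in>T. mi_order \<tau>)"
  have less: "\<sigma> i < N" if "\<sigma> \<in> T" for \<sigma> i
  proof -
    have "\<sigma> i \<le> mi_order \<sigma>" unfolding mi_order_def by (rule member_le_sum) auto
    also have "\<dots> \<le> (\<Sum>\<tau>\<in>T. mi_order \<tau>)" by (rule member_le_sum) (use that T in auto)
    finally show ?thesis by (simp add: N_def)
  qed
  define K where "K \<sigma> = (\<Sum>i\<in>UNIV. \<sigma> i * N ^ e i)" for \<sigma> :: "'n multi_index"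
  define d where "d = the_inv_into UNIV e"
  have d: "bij_betw d {..<CARD('n)} UNIV" unfolding d_def by (rule bij_betw_the_inv_into[OF e])
  have ed: "e (d j) = j" if "j < CARD('n)" for j
    unfolding d_def using e that by (intro f_the_inv_into_f_bij_betw) auto
  have K_eq: "K \<sigma> = (\<Sum>j<CARD('n). \<sigma> (d j) * N ^ j)" for \<sigma>
    unfolding K_def sum.reindex_bij_betw[OF d, symmetric] by (intro sum.cong) (auto simp: ed)
  have K_inj: "\<sigma> = \<sigma>'" if "\<sigma> \<in> T" "\<sigma>' \<in> T" "K \<sigma> = K \<sigma>'" for \<sigma> \<sigma>'
  proof
    fix i
    obtain j where "j < CARD('n)" "i = d j"
      using d by (metis UNIV_I bij_betw_imp_surj_on imageE lessThan_iff)
    then show "\<sigma> i = \<sigma>' i"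
      using digits_unique[of "CARD('n)" "\<lambda>j. \<sigma> (d j)" N "\<lambda>j. \<sigma>' (d j)" j] less that K_eq by simp
  qed
  define p where "p = (\<Sum>\<sigma>\<in>T. monom (b \<sigma>) (K \<sigma>))"
  have "poly p t = 0" if t: "0 < t" "t < min r 1" for t
  proof -
    define x :: "real^'n" where "x = (\<chi> i. t ^ N ^ e i)"
    have "\<bar>x $ i\<bar> < r" for i
    proof -
      \<comment> \<open>As t < 1 and every exponent is at least 1, no coordinate exceeds t, which
        keeps the point in the cube.\<close>
      have "t ^ N ^ e i \<le> t ^ 1" using t by (intro power_decreasing) (auto simp: N_def)
      then show ?thesis using t by (simp add: x_def)
    qed
    then have "(\<Sum>\<sigma>\<in>T. b \<sigma> * monomial \<sigma> x) = 0" using zero by simp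
    moreover have "monomial \<sigma> x = t ^ K \<sigma>" for \<sigma>
      by (simp add: monomial_def x_def K_def power_sum mult.commute flip: power_mult)
    ultimately show ?thesis by (simp add: p_def poly_sum poly_monom)
  qed
  then have "{0<..<min r 1} \<subseteq> {t. poly p t = 0}" by auto
  moreover have "infinite {0<..<min r 1}" using r by (simp add: infinite_Ioo)
  ultimately have "p = 0" using poly_roots_finite finite_subset by blast
  \<comment> \<open>By injectivity of \<open>K\<close> on \<open>T\<close>, only \<tau> contributes
    to this coefficient.\<close>
  then have "0 = coeff p (K \<tau>)" by simp
  also have "\<dots> = (\<Sum>\<sigma>\<in>T. if \<sigma> = \<tau> then b \<sigma> else 0)"
    unfolding p_def coeff_sum using K_inj[OF _ \<tau>] by (intro sum.cong) auto
  also have "\<dots> = b \<tau>" using T \<tau> by simp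
  finally show ?thesis by simp
qed

text \<open>Coefficients are functions on the full index type with the product topology. Forcing
  zeros off \<open>T\<close> places the sphere as a closed subset in a product of compact sets, so
  Tychonoff applies.\<close>

lemma compact_coefficient_sphere:
  assumes T: "finite T"
  shows "compact {b :: 'a \<Rightarrow> real. (\<forall>\<tau>. \<tau> \<notin> T \<longrightarrow> b \<tau> = 0) \<and> (\<Sum>\<tau>\<in>T. \<bar>b \<tau>\<bar>) = 1}"
proof -
  define P where "P = PiE UNIV (\<lambda>\<tau>. if \<tau> \<in> T then {-1..1::real} else {0})"
  have "compactin (product_topology (\<lambda>i. euclidean) UNIV) P"
    unfolding P_def compactin_PiE by auto
  then have "compact P" by (simp add: euclidean_product_topology)
  moreover have "closed {b. (\<Sum>\<tau>\<in>T. \<bar>b \<tau>\<bar>) = (1::real)}"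
    by (intro closed_Collect_eq continuous_intros continuous_on_product_coordinates)
  ultimately have "compact (P \<inter> {b. (\<Sum>\<tau>\<in>T. \<bar>b \<tau>\<bar>) = 1})"
    by (rule compact_Int_closed)
  moreover have "{b. (\<forall>\<tau>. \<tau> \<notin> T \<longrightarrow> b \<tau> = 0) \<and> (\<Sum>\<tau>\<in>T. \<bar>b \<tau>\<bar>) = 1} = P \<inter> {b. (\<Sum>\<tau>\<in>T. \<bar>b \<tau>\<bar>) = 1}"
  proof -
    have "\<bar>b \<tau>\<bar> \<le> 1" if "(\<Sum>\<tau>\<in>T. \<bar>b \<tau>\<bar>) = 1" "\<tau> \<in> T" for b :: "'a \<Rightarrow> real" and \<tau>
      using member_le_sum[of \<tau> T "\<lambda>\<tau>. \<bar>b \<tau>\<bar>"] T that by simp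
    then show ?thesis by (force simp: P_def PiE_def Pi_def abs_le_iff)
  qed
  ultimately show ?thesis by simp
qed

text \<open>Weighting by a bump function supported in a cube still gives a definite form on
  polynomials of bounded degree, so compactness of the unit sphere of coefficients applies.\<close>

lemma polynomial_coercive:
  fixes T :: "'n::finite multi_index set" and r :: real
  assumes T: "finite T" and r: "r > 0"
  defines "\<eta> \<equiv> box_bump (\<chi> i. - r) (\<chi> i. r) 1"
  obtains c where "c > 0" "\<And>b. c * (\<Sum>\<tau>\<in>T. \<bar>b \<tau>\<bar>)\<^sup>2
    \<le> (LINT x|lborel. \<eta> x * (\<Sum>\<tau>\<in>T. b \<tau> * monomial \<tau> x)\<^sup>2)"
proof -
  define Q where "Q b = (LINT x|lborel. \<eta> x * (\<Sum>\<tau>\<in>T. b \<tau> * monomial \<tau> x)\<^sup>2)" for b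
  define S where "S b = (\<Sum>\<tau>\<in>T. \<bar>b \<tau>\<bar>)" for b :: "'n multi_index \<Rightarrow> real"
  have \<eta>: "\<eta> \<in> test_functions UNIV" unfolding \<eta>_def by (rule box_bump_test_function) auto
  have integ: "integrable lborel (\<lambda>x. f x * \<eta> x)" if "smooth f" for f
    using test_functions_integrable[OF test_functions_mult[OF that \<eta>]] .
  \<comment> \<open>The weighted Gram matrix; it displays \<open>Q\<close> as a finite quadratic
    expression in the coefficients, whence its continuity and homogeneity.\<close>
  define G where "G \<tau> \<tau>' = (LINT x|lborel. (monomial \<tau> x * monomial \<tau>' x) * \<eta> x)" for \<tau> \<tau>'
  have G: "integrable lborel (\<lambda>x. (monomial \<tau> x * monomial \<tau>' x) * \<eta> x)" for \<tau> \<tau>'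
    by (intro integ smooth_mult smooth_monomial)
  have Q_eq: "Q b = (\<Sum>\<tau>\<in>T. \<Sum>\<tau>'\<in>T. b \<tau> * b \<tau>' * G \<tau> \<tau>')" for b
  proof -
    have "Q b = (LINT x|lborel. (\<Sum>\<tau>\<in>T. \<Sum>\<tau>'\<in>T. b \<tau> * b \<tau>' * ((monomial \<tau> x * monomial \<tau>' x) * \<eta> x)))"
      unfolding Q_def by (simp add: power2_eq_square sum_product sum_distrib_left mult_ac)
    also have "\<dots> = (\<Sum>\<tau>\<in>T. \<Sum>\<tau>'\<in>T. b \<tau> * b \<tau>' * G \<tau> \<tau>')"
      unfolding G_def using G by simp
    finally show ?thesis .
  qed
  have Q_cont: "continuous_on UNIV Q"
    unfolding Q_eq[abs_def] by (intro continuous_intros continuous_on_product_coordinates)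
  have Q_scale: "Q (\<lambda>\<tau>. t * b \<tau>) = t\<^sup>2 * Q b" for t b
    unfolding Q_eq by (simp add: sum_distrib_left power2_eq_square mult_ac)
  have Q_pos: "Q b > 0" if "S b = 1" for b
  proof -
    let ?p = "\<lambda>x. \<Sum>\<tau>\<in>T. b \<tau> * monomial \<tau> x"
    have p: "smooth ?p" by (intro smooth_sum smooth_mult smooth_const smooth_monomial)
    have nonneg: "0 \<le> \<eta> x * (?p x)\<^sup>2" for x
      unfolding \<eta>_def by (intro mult_nonneg_nonneg box_bump_bounds) simp
    have "Q b \<noteq> 0"
    proof
      assume "Q b = 0"
      moreover have "integrable lborel (\<lambda>x. \<eta> x * (?p x)\<^sup>2)"
        using integ[OF smooth_power[OF p, of 2]] by (simp add: mult.commute)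
      ultimately have "AE x in lborel. \<eta> x * (?p x)\<^sup>2 = 0"
        unfolding Q_def using integral_nonneg_eq_0_iff_AE nonneg by blast
      then have "AE x in lebesgue. \<eta> x * (?p x)\<^sup>2 = 0" by (simp only: AE_completion_iff)
      then have neg: "negligible {x. \<eta> x * (?p x)\<^sup>2 \<noteq> 0}"
        by (simp add: negligible_iff_null_sets completion.AE_iff_null_sets)
      \<comment> \<open>On the box the weight is positive, so this open set lies in a null set and
        is therefore empty.\<close>
      let ?U = "box (\<chi> i. - r) (\<chi> i. r) \<inter> {x. ?p x \<noteq> 0}"
      have "?U \<subseteq> {x. \<eta> x * (?p x)\<^sup>2 \<noteq> 0}"
        by (auto simp: \<eta>_def box_bump_eq_0_iff)
      then have "negligible ?U" using neg negligible_subset by blast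
      moreover have "open ?U"
        by (intro open_Int open_box open_Collect_neq smooth_continuous_on[OF p] continuous_on_const)
      ultimately have "?U = {}" using open_not_negligible by blast
      then have "?p x = 0" if "\<And>i. \<bar>x $ i\<bar> < r" for x
      proof -
        have "x \<in> box (\<chi> i. - r) (\<chi> i. r)" using that by (auto simp: mem_box_cart abs_less_iff minus_less_iff)
        with \<open>?U = {}\<close> show ?thesis by blast
      qed
      then have "b \<tau> = 0" if "\<tau> \<in> T" for \<tau>
        using monomials_independent[OF T r _ that] by blast
      then show False using \<open>S b = 1\<close> by (simp add: S_def)
    qed
    moreover have "Q b \<ge> 0"
      unfolding Q_def using nonneg by (intro Bochner_Integration.integral_nonneg) auto
    ultimately show ?thesis by simp
  qed
  define C where "C = {b. (\<forall>\<tau>. \<tau> \<notin> T \<longrightarrow> b \<tau> = 0) \<and> S b = 1}"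
  have "compact C" unfolding C_def S_def by (rule compact_coefficient_sphere[OF T])
  obtain c where c: "c > 0" "\<And>b. b \<in> C \<Longrightarrow> c \<le> Q b"
  \<comment> \<open>The sphere is empty when \<open>T\<close> is, and then any positive constant
    will do.\<close>
  proof (cases "C = {}")
    case False
    from continuous_attains_inf[OF \<open>compact C\<close> this continuous_on_subset[OF Q_cont subset_UNIV]]
    obtain b where "b \<in> C" "\<And>b'. b' \<in> C \<Longrightarrow> Q b \<le> Q b'" by blast
    then show ?thesis using that[of "Q b"] Q_pos by (auto simp: C_def)
  qed (use that[of 1] in simp)
  \<comment> \<open>Both sides are homogeneous of degree two and see only the coefficients in
    \<open>T\<close>, so \<open>b\<close> may be normalised and cut to zero off
    \<open>T\<close>.\<close>
  have "c * (S b)\<^sup>2 \<le> Q b" for b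
  proof (cases "S b = 0")
    case True
    have "b \<tau> = 0" if "\<tau> \<in> T" for \<tau>
      using True that T by (simp add: S_def sum_nonneg_eq_0_iff)
    then have "Q b = 0" by (simp add: Q_eq)
    with True show ?thesis by simp
  next
    case False
    have "S b \<ge> 0" by (simp add: S_def sum_nonneg)
    with False have "S b > 0" by simp
    define b' where "b' \<tau> = (if \<tau> \<in> T then b \<tau> / S b else 0)" for \<tau>
    have "S b' = (\<Sum>\<tau>\<in>T. \<bar>b \<tau>\<bar> / S b)"
      unfolding S_def[of b'] b'_def using \<open>S b > 0\<close> by (intro sum.cong) auto
    also have "\<dots> = (\<Sum>\<tau>\<in>T. \<bar>b \<tau>\<bar>) / S b" by (simp only: sum_divide_distrib)
    also have "\<dots> = 1" using False by (simp add: S_def)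
    finally have "b' \<in> C" using False by (simp add: C_def b'_def)
    then have "c \<le> Q b'" by (rule c(2))
    moreover have "Q b = Q (\<lambda>\<tau>. S b * b' \<tau>)"
      unfolding Q_def b'_def using False by (intro arg_cong[where f = "integral\<^sup>L lborel"] ext) simp
    ultimately show ?thesis by (simp add: Q_scale mult.commute mult_right_mono)
  qed
  then show ?thesis using that c(1) unfolding S_def Q_def by blast
qed

section \<open>The inverse estimate\<close>

lemma lborel_integral_scale:
  fixes F :: "real^'n::finite \<Rightarrow> real"
  assumes "h > 0" "F \<in> borel_measurable borel"
  shows "(LINT x|lborel. F ((1 / h) *\<^sub>R x)) = h ^ CARD('n) * (LINT x|lborel. F x)"
proof -
  have "(LINT x|lborel. F ((1 / h) *\<^sub>R x))
      = (LINT x|density (distr lborel borel (\<lambda>x. 0 + h *\<^sub>R x)) (\<lambda>_. \<bar>h\<bar> ^ DIM(real^'n)). F ((1 / h) *\<^sub>R x))"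
    using lborel_affine[of h "0::real^'n"] assms(1) by simp
  also have "\<dots> = (LINT x|distr lborel borel (\<lambda>x. 0 + h *\<^sub>R x). \<bar>h\<bar> ^ DIM(real^'n) *\<^sub>R F ((1 / h) *\<^sub>R x))"
    by (rule integral_density) (use assms in auto)
  also have "\<dots> = (LINT x|lborel. \<bar>h\<bar> ^ DIM(real^'n) *\<^sub>R F ((1 / h) *\<^sub>R (0 + h *\<^sub>R x)))"
    by (rule integral_distr) (use assms in auto)
  also have "\<dots> = h ^ CARD('n) * (LINT x|lborel. F x)"
    using assms(1) by simp
  finally show ?thesis .
qed

text \<open>A dilated bump is again a box bump, so the support criterion for test functions applies
  to it.\<close>

lemma box_bump_scale:
  "h > 0 \<Longrightarrow> box_bump a b m ((1 / h) *\<^sub>R x) = box_bump (h *\<^sub>R a) (h *\<^sub>R b) (m / h) x"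
  by (simp add: box_bump_def field_simps)

text \<open>Serves both for \<open>f\<close> and for the derivatives of v.\<close>

lemma integral_square_le:
  fixes g :: "real^'n::finite \<Rightarrow> real"
  assumes \<Omega>: "open \<Omega>" "bounded \<Omega>" and h: "h > 0"
    and sub: "\<And>x i. x \<in> \<Omega> \<Longrightarrow> \<bar>x $ i\<bar> \<le> h"
    and g: "\<And>x. x \<in> \<Omega> \<Longrightarrow> \<bar>g x\<bar> \<le> B"
  shows "(LINT x|lebesgue_on \<Omega>. (g x)\<^sup>2) \<le> B\<^sup>2 * (2 * h) ^ CARD('n)"
proof -
  have m: "\<Omega> \<in> lmeasurable" using \<Omega> by (simp add: lmeasurable_open)
  interpret finite_measure "lebesgue_on \<Omega>" using m by (rule finite_measure_lebesgue_on)
  have "(LINT x|lebesgue_on \<Omega>. (g x)\<^sup>2) \<le> (LINT x|lebesgue_on \<Omega>. B\<^sup>2)"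
  proof (rule integral_mono')
    show "(g x)\<^sup>2 \<le> B\<^sup>2" if "x \<in> space (lebesgue_on \<Omega>)" for x
      using g[of x] that by (intro abs_le_square_iff[THEN iffD1]) auto
  qed auto
  also have "\<dots> = B\<^sup>2 * measure lebesgue \<Omega>"
    using m by (simp add: measure_restrict_space fmeasurableD mult.commute)
  also have "measure lebesgue \<Omega> \<le> measure lebesgue (cbox (\<chi> i. - h) (\<chi> i. h) :: (real^'n) set)"
    using sub m by (intro measure_mono_fmeasurable) (auto simp: mem_box_cart abs_le_iff minus_le_iff fmeasurableD)
  also have "\<dots> = (2 * h) ^ CARD('n)"
  proof -
    have "cbox (\<chi> i. - h) (\<chi> i. h) \<noteq> ({} :: (real^'n) set)"
      using h by (auto simp: set_eq_iff mem_box_cart intro!: exI[of _ 0])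
    then show ?thesis by (simp add: content_cbox_cart)
  qed
  finally show ?thesis by (simp add: mult_left_mono)
qed

theorem lemma4p1:
  fixes k s :: nat and \<delta> :: real
  assumes "k \<ge> 1" and "s \<ge> 1" and "\<delta> > 0"
  shows "\<exists>C>0. \<forall>(h::real) (\<Omega> :: (real^'n) set).
           h > 0 \<longrightarrow> open \<Omega> \<longrightarrow> bounded \<Omega> \<longrightarrow> smooth_boundary \<Omega> \<longrightarrow>
           diameter \<Omega> \<le> h \<longrightarrow> ball 0 (\<delta> * h / 2) \<subseteq> \<Omega> \<longrightarrow>
           (\<forall>u \<in> calL_inv_image k \<Omega> (polys (s - 1)).
              L2_norm_on \<Omega> (calL k \<Omega> u) \<le> C * h powi (- int k) * Hk_seminorm k \<Omega> u)"
proof -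
  define T where "T = {\<tau> :: 'n multi_index. mi_order \<tau> \<le> s - 1}"
  define A where "A = {\<sigma> :: 'n multi_index. mi_order \<sigma> = k}"
  define n where "n = CARD('n)"
  have T: "finite T" unfolding T_def by (rule finite_multi_indices)
  have A: "finite A" unfolding A_def by (rule finite_subset[OF _ finite_multi_indices[of k]]) auto
  have n: "n > 0" by (simp add: n_def)
  \<comment> \<open>In the cube of half side \<open>r\<close> the l1 norm is at most \<delta>/4, so
    its dilate by h lies in the ball of radius \<delta> h/2.\<close>
  define r where "r = \<delta> / (4 * real n)"
  have r: "r > 0" using assms(3) n by (simp add: r_def)
  define \<eta> :: "real^'n \<Rightarrow> real" where "\<eta> = box_bump (\<chi> i. - r) (\<chi> i. r) 1"
  have \<eta>: "\<eta> \<in> test_functions UNIV" unfolding \<eta>_def by (rule box_bump_test_function) auto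
  obtain c where c: "c > 0" "\<And>b. c * (\<Sum>\<tau>\<in>T. \<bar>b \<tau>\<bar>)\<^sup>2
      \<le> (LINT x|lborel. \<eta> x * (\<Sum>\<tau>\<in>T. b \<tau> * monomial \<tau> x)\<^sup>2)"
    by (rule polynomial_coercive[OF T r, folded \<eta>_def]) (rule that)
  \<comment> \<open>Cut-off monomials: the rescaled test function is a combination of these with
    coefficients \<open>b\<close>.\<close>
  define w where "w \<tau> x = monomial \<tau> x * \<eta> x" for \<tau> x
  have w: "w \<tau> \<in> test_functions UNIV" for \<tau>
    unfolding w_def[abs_def] by (rule test_functions_mult[OF smooth_monomial \<eta>])
  have "\<exists>M\<ge>0. \<forall>x. \<bar>D \<sigma> (w \<tau>) x\<bar> \<le> M" for \<sigma> \<tau>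
    using test_functions_bounded[OF test_functions_D[OF w]] by metis
  then obtain M0 where M0: "\<And>\<sigma> \<tau>. M0 \<sigma> \<tau> \<ge> 0" "\<And>\<sigma> \<tau> x. \<bar>D \<sigma> (w \<tau>) x\<bar> \<le> M0 \<sigma> \<tau>" by metis
  \<comment> \<open>Only finitely many pairs occur; the sum dominates each individual bound.\<close>
  define M where "M = (\<Sum>\<sigma>\<in>A. \<Sum>\<tau>\<in>T. M0 \<sigma> \<tau>)"
  have M: "\<bar>D \<sigma> (w \<tau>) x\<bar> \<le> M" if "\<sigma> \<in> A" "\<tau> \<in> T" for \<sigma> \<tau> x
  proof -
    have "M0 \<sigma> \<tau> \<le> (\<Sum>\<tau>\<in>T. M0 \<sigma> \<tau>)" using that T M0(1) by (intro member_le_sum) auto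
    also have "\<dots> \<le> M" unfolding M_def using that A M0(1)
      by (intro member_le_sum[of \<sigma> A "\<lambda>\<sigma>. \<Sum>\<tau>\<in>T. M0 \<sigma> \<tau>"] sum_nonneg) auto
    finally show ?thesis using M0(2) order_trans by blast
  qed
  have "M \<ge> 0" unfolding M_def using M0(1) by (intro sum_nonneg)
  \<comment> \<open>The quotient is what the final inequality yields; adding 1 makes the constant
    strictly positive.\<close>
  define C where "C = M * sqrt (card A) * 2 ^ n / c + 1"
  have C: "C > 0" using \<open>M \<ge> 0\<close> c(1) by (simp add: C_def add_nonneg_pos)
  show ?thesis
  proof (intro exI conjI allI impI ballI)
    show "C > 0" by (rule C)
    fix h :: real and \<Omega> :: "(real^'n) set" and u
    assume h: "h > 0" and \<Omega>: "open \<Omega>" "bounded \<Omega>" and diam: "diameter \<Omega> \<le> h"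
      and ball: "ball 0 (\<delta> * h / 2) \<subseteq> \<Omega>" and u: "u \<in> calL_inv_image k \<Omega> (polys (s - 1))"
    obtain f where f: "f \<in> polys (s - 1)" "f \<in> L2 \<Omega>" "weak_solution k \<Omega> f u"
      using u by (auto simp: calL_inv_image_def)
    then obtain a where a: "f = (\<lambda>x. \<Sum>\<tau>\<in>T. a \<tau> * monomial \<tau> x)"
      by (auto simp: polys_def T_def monomial_def)
    \<comment> \<open>The coefficients of the rescaled polynomial f(h y).\<close>
    define b where "b \<tau> = a \<tau> * h ^ mi_order \<tau>" for \<tau>
    define p where "p y = (\<Sum>\<tau>\<in>T. b \<tau> * monomial \<tau> y)" for y
    have fp: "f x = p ((1 / h) *\<^sub>R x)" for x
      using h by (simp add: a p_def b_def monomial_scale power_divide)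
    define S where "S = (\<Sum>\<tau>\<in>T. \<bar>b \<tau>\<bar>)"
    have "S \<ge> 0" by (simp add: S_def sum_nonneg)
    have "0 \<in> \<Omega>" using ball assms(3) h by (auto intro!: subsetD[OF ball])
    \<comment> \<open>The origin belongs to \<Omega>, so the diameter bounds the norm of every
      point.\<close>
    have coord: "\<bar>x $ i\<bar> \<le> h" if "x \<in> \<Omega>" for x i
      using diameter_bounded_bound[OF \<Omega>(2) \<open>0 \<in> \<Omega>\<close> that] diam component_le_norm_cart[of x i]
      by simp
    have f_le: "\<bar>f x\<bar> \<le> S" if "x \<in> \<Omega>" for x
    proof -
      have "\<bar>monomial \<tau> ((1 / h) *\<^sub>R x)\<bar> \<le> 1" for \<tau>
        using coord[OF that] h by (intro abs_monomial_le_1) (simp add: abs_mult field_simps)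
      then show ?thesis
        unfolding fp p_def S_def
        by (intro order_trans[OF sum_abs] sum_mono) (simp add: abs_mult mult_left_le)
    qed
    have norm_f: "L2_norm_on \<Omega> f \<le> S * sqrt ((2 * h) ^ n)"
    proof -
      have "(LINT x|lebesgue_on \<Omega>. (f x)\<^sup>2) \<le> S\<^sup>2 * (2 * h) ^ n"
        unfolding n_def using integral_square_le[OF \<Omega> h coord f_le] .
      then have "L2_norm_on \<Omega> f \<le> sqrt (S\<^sup>2 * (2 * h) ^ n)"
        unfolding L2_norm_on_def by simp
      then show ?thesis using \<open>S \<ge> 0\<close> by (simp add: real_sqrt_mult)
    qed

    \<comment> \<open>The profile \<eta> p in the rescaled variable; v is its dilate.\<close>
    define W where "W y = (\<Sum>\<tau>\<in>T. b \<tau> * w \<tau> y)" for y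
    have W: "smooth W"
      unfolding W_def[abs_def] by (intro smooth_sum smooth_mult smooth_const test_functions_smooth[OF w])
    define v where "v x = W ((1 / h) *\<^sub>R x)" for x
    have v_eq: "v = (\<lambda>x. f x * box_bump (h *\<^sub>R (\<chi> i. - r)) (h *\<^sub>R (\<chi> i. r)) (1 / h) x)"
      unfolding v_def W_def w_def fp p_def sum_distrib_right \<eta>_def
      by (simp add: box_bump_scale[OF h] mult.assoc)
    have "cbox (h *\<^sub>R (\<chi> i. - r)) (h *\<^sub>R (\<chi> i. r)) \<subseteq> \<Omega>"
    proof
      fix x :: "real^'n" assume "x \<in> cbox (h *\<^sub>R (\<chi> i. - r)) (h *\<^sub>R (\<chi> i. r))"
      then have "\<bar>x $ i\<bar> \<le> h * r" for i by (auto simp: mem_box_cart abs_le_iff minus_le_iff)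
      then have "(\<Sum>i\<in>UNIV. \<bar>x $ i\<bar>) \<le> (\<Sum>i\<in>(UNIV::'n set). h * r)" by (intro sum_mono)
      also have "\<dots> = \<delta> * h / 4" using n by (simp add: r_def n_def)
      also have "\<dots> < \<delta> * h / 2" using assms(3) h by simp
      finally have "norm x < \<delta> * h / 2" using norm_le_l1_cart[of x] by simp
      then show "x \<in> \<Omega>" using ball by auto
    qed
    moreover have "smooth f"
      unfolding a by (intro smooth_sum smooth_mult smooth_const smooth_monomial)
    ultimately have v: "v \<in> test_functions \<Omega>"
      unfolding v_eq using h by (intro test_functions_mult box_bump_test_function) auto

    have Dv: "\<bar>D \<sigma> v x\<bar> \<le> (1 / h) ^ k * (M * S)" if \<sigma>: "\<sigma> \<in> A" for \<sigma> x
    proof -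
      \<comment> \<open>A list of length \<open>k\<close> opens the way to the dilation rule, giving
        k factors 1/h.\<close>
      obtain "is" where l: "length is = k" "\<And>f. smooth f \<Longrightarrow> D \<sigma> f = iter_partial is f"
        using \<sigma> by (metis (mono_tags, lifting) A_def mem_Collect_eq obtain_D_list)
      have "D \<sigma> v = (\<lambda>x. (1 / h) ^ k * iter_partial is W ((1 / h) *\<^sub>R x))"
        unfolding l(2)[OF test_functions_smooth[OF v]] unfolding v_def[abs_def] iter_partial_scale[OF W] l(1) ..
      moreover have "iter_partial is W = (\<lambda>y. \<Sum>\<tau>\<in>T. b \<tau> * D \<sigma> (w \<tau>) y)"
        unfolding W_def[abs_def] l(2)[OF test_functions_smooth[OF w]]
        by (simp add: iter_partial_sum iter_partial_cmult smooth_mult smooth_const test_functions_smooth[OF w])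
      moreover have "\<bar>\<Sum>\<tau>\<in>T. b \<tau> * D \<sigma> (w \<tau>) y\<bar> \<le> M * S" for y
      proof -
        have "\<bar>\<Sum>\<tau>\<in>T. b \<tau> * D \<sigma> (w \<tau>) y\<bar> \<le> (\<Sum>\<tau>\<in>T. \<bar>b \<tau>\<bar> * M)"
          using M[OF \<sigma>] by (intro order_trans[OF sum_abs] sum_mono) (simp add: abs_mult mult_left_mono)
        then show ?thesis by (simp add: S_def sum_distrib_left mult.commute)
      qed
      ultimately show ?thesis using h by (simp add: abs_mult mult_left_mono)
    qed
    let ?B = "(1 / h) ^ k * (M * S)"
    have "?B \<ge> 0" using h \<open>M \<ge> 0\<close> \<open>S \<ge> 0\<close> by simp
    have "(\<Sum>\<sigma>\<in>A. LINT x|lebesgue_on \<Omega>. (D \<sigma> v x)\<^sup>2) \<le> (\<Sum>\<sigma>\<in>A. ?B\<^sup>2 * (2 * h) ^ n)"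
      unfolding n_def using integral_square_le[OF \<Omega> h coord Dv] by (intro sum_mono)
    then have "sqrt (\<Sum>\<sigma>\<in>A. LINT x|lebesgue_on \<Omega>. (D \<sigma> v x)\<^sup>2) \<le> sqrt (card A * (?B\<^sup>2 * (2 * h) ^ n))"
      by simp
    also have "\<dots> = sqrt (card A) * ?B * sqrt ((2 * h) ^ n)"
      using \<open>?B \<ge> 0\<close> by (simp only: real_sqrt_mult real_sqrt_abs abs_of_nonneg mult.assoc)
    finally have norm_v: "sqrt (\<Sum>\<sigma>\<in>A. LINT x|lebesgue_on \<Omega>. (D \<sigma> v x)\<^sup>2)
      \<le> sqrt (card A) * ?B * sqrt ((2 * h) ^ n)" .

    define U where "U = Hk_seminorm k \<Omega> u"
    have "U \<ge> 0" unfolding U_def Hk_seminorm_def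
      by (intro real_sqrt_ge_zero sum_nonneg Bochner_Integration.integral_nonneg) simp
    have p_smooth: "smooth p"
      unfolding p_def[abs_def] by (intro smooth_sum smooth_mult smooth_const smooth_monomial)
    then have F_meas: "(\<lambda>y. \<eta> y * (p y)\<^sup>2) \<in> borel_measurable borel"
      by (intro borel_measurable_continuous_onI smooth_continuous_on smooth_mult smooth_power
          test_functions_smooth[OF \<eta>])
    have f_meas: "f \<in> borel_measurable borel"
      by (intro borel_measurable_continuous_onI smooth_continuous_on \<open>smooth f\<close>)
    \<comment> \<open>Coercivity for \<open>b\<close>, then dilation back to \<Omega>, where the
      weighted square becomes f v and the weak equation applies.\<close>
    have "h ^ n * (c * S\<^sup>2) \<le> h ^ n * (LINT y|lborel. \<eta> y * (p y)\<^sup>2)"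
      using c(2)[of b] h by (simp add: S_def p_def)
    also have "\<dots> = (LINT x|lborel. \<eta> ((1 / h) *\<^sub>R x) * (p ((1 / h) *\<^sub>R x))\<^sup>2)"
      unfolding n_def by (rule lborel_integral_scale[OF h F_meas, symmetric])
    also have "\<dots> = (LINT x|lborel. f x * v x)"
      unfolding v_eq fp \<eta>_def box_bump_scale[OF h] by (simp add: power2_eq_square mult_ac)
    also have "\<dots> = (LINT x|lebesgue_on \<Omega>. f x * v x)"
      by (rule lebesgue_on_eq_lborel[OF \<Omega>(1) v f_meas, symmetric])
    also have "\<dots> \<le> U * sqrt (\<Sum>\<sigma>\<in>A. LINT x|lebesgue_on \<Omega>. (D \<sigma> v x)\<^sup>2)"
      unfolding U_def A_def by (rule weak_solution_test_le[OF \<Omega>(1) f(3) v])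
    also have "\<dots> \<le> U * (sqrt (card A) * ?B * sqrt ((2 * h) ^ n))"
      by (rule mult_left_mono[OF norm_v \<open>U \<ge> 0\<close>])
    finally have main: "S * (h ^ n * (c * S)) \<le> S * (U * (sqrt (card A) * ((1 / h) ^ k * M) * sqrt ((2 * h) ^ n)))"
      by (simp add: power2_eq_square mult_ac)
    \<comment> \<open>One factor \<open>S\<close> is cancelled; S = 0 needs separate
      treatment.\<close>
    have "h ^ n * (c * S) \<le> U * (sqrt (card A) * ((1 / h) ^ k * M) * sqrt ((2 * h) ^ n))"
    proof (cases "S = 0")
      case True
      then show ?thesis using \<open>U \<ge> 0\<close> \<open>M \<ge> 0\<close> h by simp
    next
      case False
      then show ?thesis using main \<open>S \<ge> 0\<close> by (simp add: mult_le_cancel_left)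
    qed
    \<comment> \<open>The extra root produces the bound of \<open>norm_f\<close> on the left and a
      full h^n on the right, which then cancels.\<close>
    then have "h ^ n * c * S * sqrt ((2 * h) ^ n)
        \<le> U * (sqrt (card A) * ((1 / h) ^ k * M) * sqrt ((2 * h) ^ n)) * sqrt ((2 * h) ^ n)"
      using h by (intro mult_right_mono) (simp_all add: mult.assoc)
    also have "\<dots> = U * sqrt (card A) * (1 / h) ^ k * M * (sqrt ((2 * h) ^ n) * sqrt ((2 * h) ^ n))"
      by (simp only: mult_ac)
    also have "sqrt ((2 * h) ^ n) * sqrt ((2 * h) ^ n) = 2 ^ n * h ^ n"
      using h by (simp add: power_mult_distrib)
    finally have "S * sqrt ((2 * h) ^ n) * (h ^ n * c) \<le> (M * sqrt (card A) * 2 ^ n * (1 / h) ^ k * U) * h ^ n"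
      by (simp add: mult_ac)
    then have "S * sqrt ((2 * h) ^ n) \<le> M * sqrt (card A) * 2 ^ n * (1 / h) ^ k * U / c"
      using h c(1) by (simp add: pos_le_divide_eq)
    also have "\<dots> = (M * sqrt (card A) * 2 ^ n / c) * ((1 / h) ^ k * U)" by simp
    also have "\<dots> \<le> C * ((1 / h) ^ k * U)"
      unfolding C_def using h \<open>U \<ge> 0\<close> by (intro mult_right_mono) auto
    finally have "L2_norm_on \<Omega> f \<le> C * (1 / h) ^ k * U" using norm_f by simp
    then show "L2_norm_on \<Omega> (calL k \<Omega> u) \<le> C * h powi (- int k) * Hk_seminorm k \<Omega> u"
      by (simp add: L2_norm_on_calL[OF \<Omega>(1) f(3,2)] U_def power_int_minus power_one_over inverse_eq_divide)
  qed
qed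

end
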